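(* Consider the Cauchy problem $$u_{tt}-\Delta u+b(t)u_t-g(t)\Delta u_t=0,\quad (t,x)\in[0,\infty)\times\mathbb{R}^n,\qquad u(0,x)=u_0(x),\quad u_t(0,x)=u_1(x),\quad x\in\mathbb{R}^n.$$ Assume that for all $t\in[0,\infty)$ the coefficient $g$ satisfies: (A1) $g(t)>0$ and $g'(t)>0$; (A2) $1/g\in L^1([0,\infty))$; (A3) $|d_t^k g(t)|\le C_k\, g(t)\big(\tfrac{g(t)}{G(t)}\big)^k$ for $k=1,2$, where $G(t):=\tfrac12\int_0^t g(\tau)\,d\tau$ and $C_1,C_2$ are positive constants; and that the coefficient $b=b(t)>0$ satisfies for all $t\in[0,\infty)$: (A'1) $b'(t)<0$ and $b\in L^1([0,\infty))$; (A'2) $b(t)\le \widetilde C\,\tfrac{g(t)}{G(t)}$ with a positive constant $\widetilde C$; (A'3) $|b'(t)|\le c\,\tfrac{b(t)}{1+t}$ with a positive constant $c$. Suppose that $(u_0,u_1)\in\dot H^{|\beta|}\times\dot H^{|\beta|-2}$ with $|\beta|\ge 2$. Then Sobolev solutions satisfy $$\||D|^{|\beta|}u(t,\cdot)\|_{L^2}\lesssim \|u_0\|_{\dot H^{|\beta|}}+\|u_1\|_{\dot H^{|\beta|-2}},$$ $$\||D|^{|\beta|-2}u_t(t,\cdot)\|_{L^2}\lesssim g(t)\big(\|u_0\|_{\dot H^{|\beta|}}+\|u_1\|_{\dot H^{|\beta|-2}}\big).$$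
   Context: $f\lesssim h$ means $f\le Ch$ with a constant $C>0$ independent of $t$ and of the data. $|D|^a$ is the Fourier multiplier with symbol $|\xi|^a$; $\dot H^a=\dot H^a(\mathbb{R}^n)$ is the Riesz potential space based on $L^2$ with norm $\||\xi|^a\hat f\|_{L^2}$. $|\beta|$ denotes the order of differentiation (a number). Sobolev solutions are understood via the partial Fourier transform in $x$: $\hat u(t,\xi)$ solves $\hat u_{tt}+|\xi|^2\hat u+(b(t)+g(t)|\xi|^2)\hat u_t=0$, $\hat u(0,\xi)=\hat u_0(\xi)$, $\hat u_t(0,\xi)=\hat u_1(\xi)$. The coefficients are as regular as needed for the stated derivatives to exist. At $t=0$, where $G(0)=0$, the bounds involving $g/G$ are regarded as void. *)

theory Defs
  imports "HOL-Analysis.Analysis"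
begin

section \<open>Schwartz functions and tempered distributions\<close>

primrec iter_partial :: "'a list \<Rightarrow> ('a::euclidean_space \<Rightarrow> complex) \<Rightarrow> 'a \<Rightarrow> complex" where
  "iter_partial [] f = f"
| "iter_partial (e # es) f = (\<lambda>x. frechet_derivative (iter_partial es f) (at x) e)"

definition smooth :: "('a::euclidean_space \<Rightarrow> complex) \<Rightarrow> bool" where
  "smooth f \<longleftrightarrow> (\<forall>es. set es \<subseteq> Basis \<longrightarrow> iter_partial es f differentiable_on UNIV)"

definition schwartz :: "('a::euclidean_space \<Rightarrow> complex) set" where
  "schwartz = {f. smooth f \<and>
     (\<forall>es k. set es \<subseteq> Basis \<longrightarrow> bounded (range (\<lambda>x. (1 + norm x) ^ k *\<^sub>R iter_partial es f x)))}"

definition test_fun_off0 :: "('a::euclidean_space \<Rightarrow> complex) set" where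
  "test_fun_off0 = {f. smooth f \<and> (\<exists>K. compact K \<and> 0 \<notin> K \<and> (\<forall>x. x \<notin> K \<longrightarrow> f x = 0))}"

text \<open>A distribution is a total function on all functions; only its values on
  Schwartz functions are meaningful. Continuity is boundedness by one of the
  (directed family of) Schwartz norms, \<open>M\<close> being any upper bound of that norm.\<close>

type_synonym 'a distribution = "('a \<Rightarrow> complex) \<Rightarrow> complex"

definition tempered :: "('a::euclidean_space) distribution \<Rightarrow> bool" where
  "tempered T \<longleftrightarrow>
     (\<forall>f\<in>schwartz. \<forall>h\<in>schwartz. T (\<lambda>x. f x + h x) = T f + T h) \<and>
     (\<forall>f\<in>schwartz. \<forall>c. T (\<lambda>x. c * f x) = c * T f) \<and>
     (\<exists>C N. \<forall>f\<in>schwartz. \<forall>M.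
        (\<forall>es x. set es \<subseteq> Basis \<and> length es \<le> N \<longrightarrow> (1 + norm x) ^ N * norm (iter_partial es f x) \<le> M)
        \<longrightarrow> norm (T f) \<le> C * M)"

definition regular_distr :: "('a::euclidean_space \<Rightarrow> complex) \<Rightarrow> 'a distribution" where
  "regular_distr w = (\<lambda>f. LINT x|lborel. w x * f x)"


section \<open>Fourier transform\<close>

definition fourier :: "('a::euclidean_space \<Rightarrow> complex) \<Rightarrow> 'a \<Rightarrow> complex" where
  "fourier f \<xi> = (2 * pi) powr (- real DIM('a) / 2) *\<^sub>R (LINT x|lborel. cis (- (x \<bullet> \<xi>)) * f x)"

text \<open>\<open>has_fourier T F\<close>: the Fourier transform \<open>f \<mapsto> T (fourier f)\<close> of the tempered
  distribution \<open>T\<close> coincides on the complement of the origin with the locally integrable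
  function \<open>F\<close>. Then \<open>F\<close> is unique almost everywhere, and it determines \<open>T\<close> up to a
  polynomial (a polynomial is a distribution whose Fourier transform is supported at the
  origin). The origin has to be left out because for \<open>a \<ge> n/2\<close> the Fourier transforms of
  elements of the homogeneous space of order \<open>a\<close> need not be integrable near it.\<close>

definition has_fourier :: "('a::euclidean_space) distribution \<Rightarrow> ('a \<Rightarrow> complex) \<Rightarrow> bool" where
  "has_fourier T F \<longleftrightarrow>
     F \<in> borel_measurable lborel \<and>
     (\<forall>K. compact K \<and> 0 \<notin> K \<longrightarrow> set_integrable lborel K F) \<and>
     (\<forall>f\<in>test_fun_off0. T (fourier f) = (LINT \<xi>|lborel. F \<xi> * f \<xi>))"

definition fourier_fun :: "('a::euclidean_space) distribution \<Rightarrow> 'a \<Rightarrow> complex" where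
  "fourier_fun T = (SOME F. has_fourier T F)"


section \<open>Homogeneous Sobolev spaces and fractional derivatives\<close>

definition L2 :: "('a::euclidean_space \<Rightarrow> complex) set" where
  "L2 = {f. f \<in> borel_measurable lborel \<and> integrable lborel (\<lambda>x. (norm (f x))\<^sup>2)}"

definition L2_norm :: "('a::euclidean_space \<Rightarrow> complex) \<Rightarrow> real" where
  "L2_norm f = sqrt (LINT x|lborel. (norm (f x))\<^sup>2)"

text \<open>Elements are tempered distributions, the polynomials being the null space of the
  norm; so the space itself is the quotient by polynomials.\<close>

definition Hdot :: "real \<Rightarrow> ('a::euclidean_space) distribution set" where
  "Hdot a = {T. tempered T \<and> (\<exists>F. has_fourier T F) \<and>
                (\<lambda>\<xi>. (norm \<xi> powr a) *\<^sub>R fourier_fun T \<xi>) \<in> L2}"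

definition Hdot_norm :: "real \<Rightarrow> ('a::euclidean_space) distribution \<Rightarrow> real" where
  "Hdot_norm a T = L2_norm (\<lambda>\<xi>. (norm \<xi> powr a) *\<^sub>R fourier_fun T \<xi>)"

text \<open>\<open>is_frac_deriv a T S\<close>: \<open>S = |D|\<^sup>a T\<close>, for the Fourier multiplier with symbol
  \<open>|\<xi>|\<^sup>a\<close>, up to polynomials. If \<open>S\<close> is given by an \<open>L\<^sup>2\<close> function, that function is
  unique almost everywhere.\<close>

definition is_frac_deriv :: "real \<Rightarrow> ('a::euclidean_space) distribution \<Rightarrow> 'a distribution \<Rightarrow> bool" where
  "is_frac_deriv a T S \<longleftrightarrow>
     (\<exists>F. has_fourier T F \<and> has_fourier S (\<lambda>\<xi>. (norm \<xi> powr a) *\<^sub>R F \<xi>))"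


section \<open>Sobolev solutions\<close>

text \<open>\<open>u\<close> is a Sobolev solution with time derivative \<open>ut\<close>. Both are given by their partial
  Fourier transforms with respect to \<open>x\<close>; \<open>v\<close>, \<open>vt\<close>, \<open>vtt\<close> are the transform of \<open>u\<close> and its
  first and second derivatives in \<open>t\<close> (one-sided at \<open>t = 0\<close>).\<close>

definition sobolev_solution ::
  "(real \<Rightarrow> real) \<Rightarrow> (real \<Rightarrow> real) \<Rightarrow> ('a::euclidean_space) distribution \<Rightarrow> 'a distribution
    \<Rightarrow> (real \<Rightarrow> 'a distribution) \<Rightarrow> (real \<Rightarrow> 'a distribution) \<Rightarrow> bool" where
  "sobolev_solution b g u0 u1 u ut \<longleftrightarrow>
     (\<forall>t\<ge>0. tempered (u t) \<and> tempered (ut t)) \<and>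
     (\<exists>v vt vtt :: real \<Rightarrow> 'a \<Rightarrow> complex.
        (\<forall>t\<ge>0. has_fourier (u t) (v t) \<and> has_fourier (ut t) (vt t)) \<and>
        (AE \<xi> in lborel.
           (\<forall>t\<ge>0. ((\<lambda>s. v s \<xi>) has_vector_derivative vt t \<xi>) (at t within {0..}) \<and>
                   ((\<lambda>s. vt s \<xi>) has_vector_derivative vtt t \<xi>) (at t within {0..}) \<and>
                   vtt t \<xi> + (norm \<xi>)\<^sup>2 *\<^sub>R v t \<xi> + (b t + g t * (norm \<xi>)\<^sup>2) *\<^sub>R vt t \<xi> = 0) \<and>
           v 0 \<xi> = fourier_fun u0 \<xi> \<and> vt 0 \<xi> = fourier_fun u1 \<xi>))"

end

theory Submission
  imports Defs "HOL-Probability.Probability"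
begin

text \<open>
  On the Fourier side the equation decouples into one damped oscillator
  \<open>v'' + p\<^sup>2 v + (b + g p\<^sup>2) v' = 0\<close> for each frequency \<open>p = |\<xi>|\<close>, and the theorem follows from
  bounds on \<open>v\<close> and \<open>v'\<close> that are uniform in \<open>p\<close>.

  The damping tends to make \<open>|v'|\<close> relax, at a rate of at least \<open>g p\<^sup>2\<close>, towards
  \<open>p\<^sup>2 |v| / (g p\<^sup>2) = |v| / g\<close>. Hence \<open>|v| + |v'| / (g p\<^sup>2)\<close> is the right quantity to follow:
  since \<open>g\<close> increases and \<open>b \<ge> 0\<close>, its growth rate is formally at most \<open>|v| / g\<close>, so Gronwall's
  inequality and the integrability of \<open>1 / g\<close> bound it for all times by a constant times
  its initial value \<open>|v(0)| + |v'(0)| / (g(0) p\<^sup>2)\<close>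
  (\<open>damped_oscillator_position_bound\<close>). Inserting this into the first-order equation for \<open>v'\<close> gives
  \<open>|v'(t)| \<le> |v'(0)| + t p\<^sup>2 sup |v|\<close> (\<open>damped_oscillator_velocity_bound\<close>). The factor \<open>t\<close> is
  controlled by \<open>g(t)\<close>: as \<open>1 / g\<close> decreases, \<open>t / g(t) \<le> \<integral> 1 / g\<close>
  (\<open>le_mult_integral_inverse_of_mono\<close>). Multiplied by powers of \<open>p\<close>, these are the two claimed
  estimates at each single frequency (\<open>damped_wave_mode_bounds\<close>).

  To return from frequencies to space, an \<open>L\<^sup>2\<close> function \<open>H\<close> on the Fourier side has to be the
  Fourier transform, in the duality sense used for distributions, of an \<open>L\<^sup>2\<close> function of no
  larger norm (\<open>L2_inverse_fourier_exists\<close>). For integrable functions everything comes from the one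
  identity \<open>parseval_regularized\<close>, in which a wide Gaussian makes the triple integral absolutely
  convergent and turns into a narrow Gaussian, an approximate identity, on the Fourier side. It
  yields the inequality of Bessel (\<open>bessel_inv_fourier\<close>) and then, letting the Gaussian widen,
  Parseval's duality (\<open>parseval_inv_fourier\<close>). Truncating \<open>H\<close> to balls and completing in \<open>L\<^sup>2\<close>
  gives the general case.
\<close>

section \<open>Damped oscillators\<close>

lemma DERIV_within_Icc_nonpos_imp_le:
  fixes f f' :: "real \<Rightarrow> real"
  assumes "a \<le> b"
    and f: "\<And>t. t \<in> {a..b} \<Longrightarrow> (f has_real_derivative f' t) (at t within {a..b})"
    and neg: "\<And>t. t \<in> {a..b} \<Longrightarrow> f' t \<le> 0"
  shows "f b \<le> f a"
proof (rule DERIV_nonpos_imp_decreasing_open[OF \<open>a \<le> b\<close>])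
  show "\<exists>y. (f has_real_derivative y) (at x) \<and> y \<le> 0" if "a < x" "x < b" for x
    using f[of x] neg[of x] that by (auto simp: at_within_Icc_at)
  show "continuous_on {a..b} f"
    using f by (rule DERIV_continuous_on)
qed

lemma norm_diff_le_of_vector_derivative_le:
  fixes f f' :: "real \<Rightarrow> 'a::real_normed_vector"
  assumes "a \<le> b"
    and f: "\<And>t. t \<in> {a..b} \<Longrightarrow> (f has_vector_derivative f' t) (at t within {a..b})"
    and h: "\<And>t. t \<in> {a..b} \<Longrightarrow> (h has_real_derivative h' t) (at t within {a..b})"
    and le: "\<And>t. t \<in> {a..b} \<Longrightarrow> norm (f' t) \<le> h' t"
  shows "norm (f b - f a) \<le> h b - h a"
proof (cases "a = b")
  case False
  with \<open>a \<le> b\<close> have "a < b" by simp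
  then show ?thesis
  proof (rule differentiable_bound_general)
    show "continuous_on {a..b} f"
      using f by (rule continuous_on_vector_derivative)
    show "continuous_on {a..b} h"
      using h by (rule DERIV_continuous_on)
    show "(f has_vector_derivative f' x) (at x)" if "a < x" "x < b" for x
      using f[of x] that by (simp add: at_within_Icc_at)
    show "(h has_vector_derivative h' x) (at x)" if "a < x" "x < b" for x
      using h[of x] that
      by (simp add: at_within_Icc_at has_real_derivative_iff_has_vector_derivative)
    show "norm (f' x) \<le> h' x" if "a < x" "x < b" for x
      using le[of x] that by simp
  qed
qed simp

text \<open>
  The norm of a solution of \<open>z' + a z = f\<close> need not be differentiable where \<open>z\<close> vanishes. Variation
  of constants supplies a differentiable majorant that satisfies the scalar comparison equation
  \<open>Y' + a Y = h\<close>, so that differential inequalities can be argued with \<open>Y\<close> in place of the norm.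
\<close>

lemma damped_norm_majorant:
  fixes z z' :: "real \<Rightarrow> 'a::real_normed_vector" and a :: "real \<Rightarrow> real"
  assumes z: "\<And>t. t \<in> {0..T} \<Longrightarrow> (z has_vector_derivative z' t) (at t within {0..T})"
    and a: "continuous_on {0..T} a" and h: "continuous_on {0..T} h"
    and le: "\<And>t. t \<in> {0..T} \<Longrightarrow> norm (z' t + a t *\<^sub>R z t) \<le> h t"
  obtains Y where "Y 0 = norm (z 0)"
    and "\<And>t. t \<in> {0..T} \<Longrightarrow> norm (z t) \<le> Y t"
    and "\<And>t. t \<in> {0..T} \<Longrightarrow> (Y has_real_derivative h t - a t * Y t) (at t within {0..T})"
proof -
  \<comment> \<open>the integrating factor \<open>exp A\<close>, and its product \<open>W\<close> with the majorant that is sought\<close>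
  define A where "A t = integral {0..t} a" for t
  have A: "(A has_real_derivative a t) (at t within {0..T})" if "t \<in> {0..T}" for t
    unfolding A_def using a that by (rule integral_has_real_derivative)
  have A0: "A 0 = 0" by (simp add: A_def)
  have contA: "continuous_on {0..T} A"
    using A by (rule DERIV_continuous_on)
  define W where "W t = norm (z 0) + integral {0..t} (\<lambda>s. exp (A s) * h s)" for t
  have W: "(W has_real_derivative exp (A t) * h t) (at t within {0..T})" if "t \<in> {0..T}" for t
    unfolding W_def
    by (rule derivative_eq_intros integral_has_real_derivative refl
        continuous_intros contA h that)+ simp
  define Y where "Y t = exp (- A t) * W t" for t
  show thesis
  proof
    show "Y 0 = norm (z 0)"
      by (simp add: Y_def W_def A0)
    fix t assume t: "t \<in> {0..T}"
    show "(Y has_real_derivative h t - a t * Y t) (at t within {0..T})"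
      unfolding Y_def
      by (rule derivative_eq_intros A[OF t] W[OF t] refl)+
         (simp add: algebra_simps exp_minus)
    have sub: "{0..t} \<subseteq> {0..T}" using t by auto
    have "norm (exp (A t) *\<^sub>R z t - exp (A 0) *\<^sub>R z 0) \<le> W t - W 0"
    proof (rule norm_diff_le_of_vector_derivative_le)
      fix s assume s: "s \<in> {0..t}"
      with t have s': "s \<in> {0..T}" by auto
      have "((\<lambda>t. exp (A t) *\<^sub>R z t) has_vector_derivative
             exp (A s) *\<^sub>R z' s + (exp (A s) * a s) *\<^sub>R z s) (at s within {0..T})"
        by (intro has_vector_derivative_scaleR z s')
           (rule derivative_eq_intros A[OF s'] refl)+
      then show "((\<lambda>t. exp (A t) *\<^sub>R z t) has_vector_derivative
             exp (A s) *\<^sub>R (z' s + a s *\<^sub>R z s)) (at s within {0..t})"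
        using sub by (auto simp: algebra_simps intro: has_vector_derivative_within_subset)
      show "(W has_real_derivative exp (A s) * h s) (at s within {0..t})"
        using W[OF s'] sub by (rule DERIV_subset)
      show "norm (exp (A s) *\<^sub>R (z' s + a s *\<^sub>R z s)) \<le> exp (A s) * h s"
        using le[OF s'] by simp
    qed (use t in auto)
    moreover have "norm (exp (A t) *\<^sub>R z t) - norm (z 0) \<le> norm (exp (A t) *\<^sub>R z t - z 0)"
      by (rule norm_triangle_ineq2)
    ultimately have "exp (A t) * norm (z t) \<le> W t"
      by (simp add: A0 W_def)
    then show "norm (z t) \<le> Y t"
      by (simp add: Y_def exp_minus field_simps)
  qed
qed

text \<open>
  Let \<open>Y\<close> be the majorant of \<open>|v'|\<close> with \<open>Y' = p\<^sup>2 |v| - a Y\<close>, and let \<open>X = |v(0)| + \<integral> Y\<close>, which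
  dominates \<open>|v|\<close>. In the derivative of \<open>X + Y / (g p\<^sup>2)\<close> the term \<open>Y\<close> coming from \<open>X\<close> is absorbed by
  \<open>a Y / (g p\<^sup>2) \<ge> Y\<close>, the derivative of \<open>1 / g\<close> has the good sign, and what remains is at most
  \<open>|v| / g \<le> X / g\<close>. Gronwall's inequality concludes. The weight \<open>1 / (g p\<^sup>2)\<close> on the velocity is what
  makes the initial velocity enter with the factor \<open>1 / p\<^sup>2\<close>, where the classical energy estimate has \<open>1 / p\<close>.
\<close>

lemma damped_oscillator_position_bound:
  fixes v v' v'' :: "real \<Rightarrow> complex" and a g g' :: "real \<Rightarrow> real"
  assumes "p \<noteq> 0" "0 \<le> T"
    and v: "\<And>t. t \<in> {0..T} \<Longrightarrow> (v has_vector_derivative v' t) (at t within {0..T})"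
    and v': "\<And>t. t \<in> {0..T} \<Longrightarrow> (v' has_vector_derivative v'' t) (at t within {0..T})"
    and eq: "\<And>t. t \<in> {0..T} \<Longrightarrow> v'' t + p\<^sup>2 *\<^sub>R v t + a t *\<^sub>R v' t = 0"
    and a: "continuous_on {0..T} a" "\<And>t. t \<in> {0..T} \<Longrightarrow> g t * p\<^sup>2 \<le> a t"
    and g: "\<And>t. t \<in> {0..T} \<Longrightarrow> (g has_real_derivative g' t) (at t within {0..T})"
    and g_pos: "\<And>t. t \<in> {0..T} \<Longrightarrow> 0 < g t"
    and g'_nonneg: "\<And>t. t \<in> {0..T} \<Longrightarrow> 0 \<le> g' t"
  shows "norm (v T) \<le> (norm (v 0) + norm (v' 0) / (g 0 * p\<^sup>2)) * exp (integral {0..T} (\<lambda>s. 1 / g s))"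
proof -
  have p2: "0 < p\<^sup>2" using \<open>p \<noteq> 0\<close> by simp
  have contv: "continuous_on {0..T} v"
    using v by (rule continuous_on_vector_derivative)
  have contg: "continuous_on {0..T} g"
    using g by (rule DERIV_continuous_on)
  have force: "norm (v'' t + a t *\<^sub>R v' t) \<le> p\<^sup>2 * norm (v t)" if "t \<in> {0..T}" for t
  proof -
    have "v'' t + a t *\<^sub>R v' t = - (p\<^sup>2 *\<^sub>R v t)"
      using arg_cong[OF eq[OF that], of "\<lambda>x. x - p\<^sup>2 *\<^sub>R v t"] by (simp add: algebra_simps)
    then show ?thesis by simp
  qed
  obtain Y where Y0: "Y 0 = norm (v' 0)"
    and Y: "\<And>t. t \<in> {0..T} \<Longrightarrow> norm (v' t) \<le> Y t"
    and Y': "\<And>t. t \<in> {0..T} \<Longrightarrow> (Y has_real_derivative p\<^sup>2 * norm (v t) - a t * Y t) (at t within {0..T})"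
    by (rule damped_norm_majorant[OF v' a(1) _ force]) (auto intro!: continuous_intros contv)
  have contY: "continuous_on {0..T} Y"
    using Y' by (rule DERIV_continuous_on)
  have Y_nonneg: "0 \<le> Y t" if "t \<in> {0..T}" for t
    using Y[OF that] norm_ge_zero order_trans by blast
  define X where "X t = norm (v 0) + integral {0..t} Y" for t
  have X': "(X has_real_derivative Y t) (at t within {0..T})" if "t \<in> {0..T}" for t
    unfolding X_def
    by (rule derivative_eq_intros integral_has_real_derivative refl contY that)+ simp
  have X: "norm (v t) \<le> X t" if t: "t \<in> {0..T}" for t
  proof -
    have sub: "{0..t} \<subseteq> {0..T}" using t by auto
    have "norm (v t - v 0) \<le> X t - X 0"
    proof (rule norm_diff_le_of_vector_derivative_le)
      fix s assume s: "s \<in> {0..t}"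
      with t have s': "s \<in> {0..T}" by auto
      show "(v has_vector_derivative v' s) (at s within {0..t})"
        using v[OF s'] sub by (rule has_vector_derivative_within_subset)
      show "(X has_real_derivative Y s) (at s within {0..t})"
        using X'[OF s'] sub by (rule DERIV_subset)
      show "norm (v' s) \<le> Y s" by (rule Y[OF s'])
    qed (use t in auto)
    moreover have "norm (v t) - norm (v 0) \<le> norm (v t - v 0)"
      by (rule norm_triangle_ineq2)
    ultimately show ?thesis by (simp add: X_def)
  qed
  define J where "J t = integral {0..t} (\<lambda>s. 1 / g s)" for t
  have J': "(J has_real_derivative 1 / g t) (at t within {0..T})" if "t \<in> {0..T}" for t
    unfolding J_def
    by (rule integral_has_real_derivative[OF _ that])
       (use g_pos in \<open>force intro!: continuous_intros contg\<close>)
  \<comment> \<open>Gronwall: \<open>F\<close> is non-increasing\<close>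
  define F where "F t = (X t + Y t / (g t * p\<^sup>2)) * exp (- J t)" for t
  define F' where "F' t =
      (Y t + ((p\<^sup>2 * norm (v t) - a t * Y t) * (g t * p\<^sup>2) - Y t * (g' t * p\<^sup>2))
               / ((g t * p\<^sup>2) * (g t * p\<^sup>2))
        - (X t + Y t / (g t * p\<^sup>2)) / g t) * exp (- J t)" for t
  have "F T \<le> F 0"
  proof (rule DERIV_within_Icc_nonpos_imp_le[where f = F and f' = F'])
    fix t assume t: "t \<in> {0..T}"
    have gt: "0 < g t" by (rule g_pos[OF t])
    have nz: "g t * p\<^sup>2 \<noteq> 0" using gt p2 by simp
    show "(F has_real_derivative F' t) (at t within {0..T})"
      unfolding F_def F'_def
      by (rule derivative_eq_intros X'[OF t] Y'[OF t] J'[OF t] g[OF t] refl nz)+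
         (simp add: algebra_simps add_divide_distrib)
    have "((p\<^sup>2 * norm (v t) - a t * Y t) * (g t * p\<^sup>2) - Y t * (g' t * p\<^sup>2)) / ((g t * p\<^sup>2) * (g t * p\<^sup>2))
        = norm (v t) / g t - a t * Y t / (g t * p\<^sup>2) - Y t * g' t / ((g t)\<^sup>2 * p\<^sup>2)"
    proof -
      have "((P * n - x) * (d * P) - y * P) / ((d * P) * (d * P)) = n / d - x / (d * P) - y / (d\<^sup>2 * P)"
        if "d \<noteq> 0" "P \<noteq> 0" for P n x d y :: real
        using that by (simp add: divide_simps) (simp add: algebra_simps power2_eq_square)
      from this[of "g t" "p\<^sup>2" "norm (v t)" "a t * Y t" "Y t * g' t"] show ?thesis
        using gt p2 by (simp add: mult.assoc)
    qed
    moreover have "Y t \<le> a t * Y t / (g t * p\<^sup>2)"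
      using a(2)[OF t] Y_nonneg[OF t] gt p2
      by (simp add: field_simps) (metis mult.commute mult_left_mono mult.assoc)
    moreover have "0 \<le> Y t * g' t / ((g t)\<^sup>2 * p\<^sup>2)" "0 \<le> Y t / (g t * p\<^sup>2) / g t"
      using Y_nonneg[OF t] g'_nonneg[OF t] gt by simp_all
    moreover have "norm (v t) / g t \<le> X t / g t"
      using X[OF t] gt by (simp add: divide_right_mono)
    ultimately show "F' t \<le> 0"
      unfolding F'_def by (intro mult_nonpos_nonneg) (auto simp: add_divide_distrib)
  qed fact
  then have "X T + Y T / (g T * p\<^sup>2) \<le> (norm (v 0) + norm (v' 0) / (g 0 * p\<^sup>2)) * exp (J T)"
    by (simp add: F_def J_def X_def Y0 exp_minus field_simps)
  moreover have "0 \<le> Y T / (g T * p\<^sup>2)"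
    using Y_nonneg[of T] g_pos[of T] \<open>0 \<le> T\<close> by simp
  moreover have "norm (v T) \<le> X T"
    using X[of T] \<open>0 \<le> T\<close> by simp
  ultimately show ?thesis by (simp add: J_def)
qed

text \<open>
  The velocity solves a first-order equation with forcing \<open>p\<^sup>2 v\<close>; damping can only help, so the
  forcing accumulates at most linearly in time.
\<close>

lemma damped_oscillator_velocity_bound:
  fixes v v' v'' :: "real \<Rightarrow> complex" and a :: "real \<Rightarrow> real"
  assumes "0 \<le> T"
    and v: "\<And>t. t \<in> {0..T} \<Longrightarrow> norm (v t) \<le> M"
    and v': "\<And>t. t \<in> {0..T} \<Longrightarrow> (v' has_vector_derivative v'' t) (at t within {0..T})"
    and eq: "\<And>t. t \<in> {0..T} \<Longrightarrow> v'' t + p\<^sup>2 *\<^sub>R v t + a t *\<^sub>R v' t = 0"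
    and a: "continuous_on {0..T} a" "\<And>t. t \<in> {0..T} \<Longrightarrow> 0 \<le> a t"
  shows "norm (v' T) \<le> norm (v' 0) + p\<^sup>2 * M * T"
proof -
  have force: "norm (v'' t + a t *\<^sub>R v' t) \<le> p\<^sup>2 * M" if "t \<in> {0..T}" for t
  proof -
    have "v'' t + a t *\<^sub>R v' t = - (p\<^sup>2 *\<^sub>R v t)"
      using arg_cong[OF eq[OF that], of "\<lambda>x. x - p\<^sup>2 *\<^sub>R v t"] by (simp add: algebra_simps)
    then show ?thesis using v[OF that] by (simp add: mult_left_mono)
  qed
  obtain Y where Y0: "Y 0 = norm (v' 0)"
    and Y: "\<And>t. t \<in> {0..T} \<Longrightarrow> norm (v' t) \<le> Y t"
    and Y': "\<And>t. t \<in> {0..T} \<Longrightarrow> (Y has_real_derivative p\<^sup>2 * M - a t * Y t) (at t within {0..T})"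
    by (rule damped_norm_majorant[OF v' a(1) _ force]) auto
  have "Y T - p\<^sup>2 * M * T \<le> Y 0 - p\<^sup>2 * M * 0"
  proof (rule DERIV_within_Icc_nonpos_imp_le[where f = "\<lambda>t. Y t - p\<^sup>2 * M * t" and f' = "\<lambda>t. - (a t * Y t)"])
    fix t assume t: "t \<in> {0..T}"
    show "((\<lambda>t. Y t - p\<^sup>2 * M * t) has_real_derivative - (a t * Y t)) (at t within {0..T})"
      by (rule derivative_eq_intros Y'[OF t] refl)+ simp
    have "0 \<le> Y t" using Y[OF t] norm_ge_zero order_trans by blast
    then show "- (a t * Y t) \<le> 0" using a(2)[OF t] by simp
  qed fact
  with Y[of T] Y0 \<open>0 \<le> T\<close> show ?thesis by simp
qed

section \<open>Gaussians and the regularized Parseval identity\<close>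

lemma
  fixes f :: "'a::euclidean_space \<Rightarrow> real \<Rightarrow> 'b::{real_normed_field,banach,second_countable_topology}"
  assumes f: "\<And>b. b \<in> Basis \<Longrightarrow> integrable lborel (f b)"
  shows integrable_lborel_prod_Basis: "integrable lborel (\<lambda>x. \<Prod>b\<in>Basis. f b (x \<bullet> b))"
    and integral_lborel_prod_Basis:
      "(LINT x|lborel. (\<Prod>b\<in>Basis. f b (x \<bullet> b))) = (\<Prod>b\<in>Basis. (LINT x|lborel. f b x))"
proof -
  interpret product_sigma_finite "\<lambda>_::'a. lborel :: real measure" ..
  have [measurable]: "f b \<in> borel_measurable borel" if "b \<in> Basis" for b
    using f[OF that] by (simp add: integrable_iff_bounded)
  have meas: "(\<lambda>x::'a. \<Prod>b\<in>Basis. f b (x \<bullet> b)) \<in> borel_measurable borel"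
    by measurable
  have coord: "(\<Prod>b\<in>Basis. f b ((\<Sum>c\<in>Basis. y c *\<^sub>R c) \<bullet> b)) = (\<Prod>b\<in>Basis. f b (y b))" for y
    by (intro prod.cong refl) simp
  show "integrable lborel (\<lambda>x. \<Prod>b\<in>Basis. f b (x \<bullet> b))"
    using product_integrable_prod[OF finite_Basis f]
    by (subst lborel_eq) (simp add: integrable_distr_eq meas coord)
  show "(LINT x|lborel. (\<Prod>b\<in>Basis. f b (x \<bullet> b))) = (\<Prod>b\<in>Basis. (LINT x|lborel. f b x))"
    using product_integral_prod[OF finite_Basis f]
    by (subst lborel_eq) (simp add: integral_distr meas coord)
qed

lemma integral_lborel_affine:
  fixes f :: "'a::euclidean_space \<Rightarrow> 'b::{banach, second_countable_topology}"
  assumes [measurable]: "f \<in> borel_measurable borel" and "c \<noteq> 0"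
  shows "(LINT x|lborel. f x) = \<bar>c\<bar> ^ DIM('a) *\<^sub>R (LINT x|lborel. f (t + c *\<^sub>R x))"
  using \<open>c \<noteq> 0\<close>
  by (subst lborel_affine[of c t])
     (simp_all add: integral_density integral_distr)

lemma borel_measurable_cis [measurable]: "cis \<in> borel_measurable borel"
  by (intro borel_measurable_continuous_onI continuous_intros)

text \<open>
  The density of the standard normal distribution.
\<close>

definition gauss :: "'a::euclidean_space \<Rightarrow> real" where
  "gauss x = (2 * pi) powr (- real DIM('a) / 2) * exp (- (norm x)\<^sup>2 / 2)"

lemma gauss_nonneg: "0 \<le> gauss x"
  by (simp add: gauss_def)

lemma gauss_minus: "gauss (- x) = gauss x"
  by (simp add: gauss_def)

lemma borel_measurable_gauss [measurable]: "gauss \<in> borel_measurable borel"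
  unfolding gauss_def by measurable

lemma norm_power2_Basis: "(norm (x :: 'a::euclidean_space))\<^sup>2 = (\<Sum>b\<in>Basis. (x \<bullet> b)\<^sup>2)"
  unfolding power2_norm_eq_inner by (subst euclidean_inner) (simp add: power2_eq_square)

lemma gauss_eq_prod: "gauss x = (\<Prod>b\<in>Basis. std_normal_density (x \<bullet> b))"
proof -
  have "- (norm x)\<^sup>2 / 2 = (\<Sum>b\<in>Basis. - (x \<bullet> b)\<^sup>2 / 2)"
    by (simp add: norm_power2_Basis sum_negf sum_divide_distrib[symmetric])
  moreover have "(2 * pi) powr (- real DIM('a) / 2) = (1 / sqrt (2 * pi)) ^ DIM('a)"
    by (simp add: powr_half_sqrt[symmetric] powr_realpow[symmetric] powr_powr powr_divide
        powr_minus_divide)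
  ultimately show ?thesis
    by (simp add: gauss_def std_normal_density_def exp_sum prod.distrib prod_dividef power_divide)
qed

lemma integrable_gauss: "integrable lborel (gauss :: 'a::euclidean_space \<Rightarrow> real)"
  unfolding gauss_eq_prod[abs_def]
  by (rule integrable_lborel_prod_Basis) simp

text \<open>
  A product over the coordinates of the characteristic function of the one-dimensional standard
  normal distribution.
\<close>

lemma fourier_gauss:
  fixes z :: "'a::euclidean_space"
  shows "(LINT x|lborel. cis (x \<bullet> z) * gauss x) = complex_of_real (exp (- (norm z)\<^sup>2 / 2))"
proof -
  have int: "integrable lborel (\<lambda>x. cis (x * s) * std_normal_density x)" for s
    by (rule Bochner_Integration.integrable_bound[of _ std_normal_density])
       (auto simp: norm_mult cis_conv_exp)
  have one: "(LINT x|lborel. cis (x * s) * std_normal_density x) = complex_of_real (exp (- s\<^sup>2 / 2))" for s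
  proof -
    have "(LINT x|lborel. cis (x * s) * std_normal_density x) = char std_normal_distribution s"
      unfolding char_def
      by (subst integral_density)
         (auto simp: cis_conv_exp scaleR_conv_of_real mult_ac intro!: Bochner_Integration.integral_cong)
    then show ?thesis
      by (simp add: char_std_normal_distribution)
  qed
  have "cis (x \<bullet> z) * gauss x = (\<Prod>b\<in>Basis. cis ((x \<bullet> b) * (z \<bullet> b)) * std_normal_density (x \<bullet> b))" for x
    by (simp add: gauss_eq_prod prod.distrib euclidean_inner[of x z] cis_conv_exp exp_sum
        sum_distrib_left)
  then have "(LINT x|lborel. cis (x \<bullet> z) * gauss x)
      = (\<Prod>b\<in>Basis. complex_of_real (exp (- (z \<bullet> b)\<^sup>2 / 2)))"
    by (simp add: integral_lborel_prod_Basis[OF int] one del: of_real_exp)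
  also have "\<dots> = complex_of_real (exp (\<Sum>b\<in>Basis. - (z \<bullet> b)\<^sup>2 / 2))"
    by (simp add: exp_sum)
  also have "(\<Sum>b\<in>Basis. - (z \<bullet> b)\<^sup>2 / 2) = - (norm z)\<^sup>2 / 2"
    by (simp add: norm_power2_Basis sum_negf sum_divide_distrib[symmetric])
  finally show ?thesis .
qed

lemma integral_gauss: "(LINT x|lborel. gauss (x :: 'a::euclidean_space)) = 1"
proof -
  have "complex_of_real (LINT x|lborel. gauss (x :: 'a)) = 1"
    using fourier_gauss[of "0::'a"] by (simp add: integral_complex_of_real[symmetric] del: integral_complex_of_real)
  then show ?thesis by (simp only: of_real_eq_1_iff)
qed

text \<open>
  The density of the centred normal distribution with standard deviation \<open>r\<close> in each coordinate,
  an approximate identity as \<open>r\<close> tends to 0.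
\<close>

definition gauss_kernel :: "real \<Rightarrow> 'a::euclidean_space \<Rightarrow> real" where
  "gauss_kernel r z = gauss (z /\<^sub>R r) / r ^ DIM('a)"

lemma fourier_wide_gaussian:
  fixes z :: "'a::euclidean_space"
  assumes "r > 0"
  shows "(LINT x|lborel. cis (x \<bullet> z) * complex_of_real (exp (- (norm (r *\<^sub>R x))\<^sup>2 / 2)))
       = (2 * pi) ^ DIM('a) * gauss_kernel r z"
proof -
  \<comment> \<open>the normalisation of \<open>gauss\<close>, which enters once from the Gaussian and once from its transform\<close>
  define c where "c = (2 * pi) powr (real DIM('a) / 2)"
  have c: "c > 0" "c * c = (2 * pi) ^ DIM('a)"
    by (simp_all add: c_def powr_add[symmetric] powr_realpow)
  have gauss_c: "exp (- (norm y)\<^sup>2 / 2) = c * gauss y" for y :: 'a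
    by (simp add: gauss_def c_def powr_minus field_simps)
  have "(LINT x|lborel. cis (x \<bullet> (z /\<^sub>R r)) * gauss x)
      = r ^ DIM('a) *\<^sub>R (LINT x|lborel. cis (x \<bullet> z) * gauss (r *\<^sub>R x))"
    using \<open>r > 0\<close> by (subst integral_lborel_affine[of _ r 0]) (simp_all add: mult.assoc[symmetric])
  moreover have "(LINT x|lborel. cis (x \<bullet> (z /\<^sub>R r)) * gauss x) = c * gauss (z /\<^sub>R r)"
    unfolding fourier_gauss gauss_c by simp
  ultimately have *: "(LINT x|lborel. cis (x \<bullet> z) * gauss (r *\<^sub>R x)) = c * gauss_kernel r z"
    using \<open>r > 0\<close> by (simp add: gauss_kernel_def scaleR_conv_of_real field_simps)
  have "(LINT x|lborel. cis (x \<bullet> z) * complex_of_real (exp (- (norm (r *\<^sub>R x))\<^sup>2 / 2)))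
      = (LINT x|lborel. c * (cis (x \<bullet> z) * gauss (r *\<^sub>R x)))"
    unfolding gauss_c by (simp add: mult_ac)
  also have "\<dots> = c * (c * gauss_kernel r z)"
    by (simp add: *)
  also have "\<dots> = (c * c) * gauss_kernel r z"
    by simp
  finally show ?thesis by (simp add: c)
qed

lemma integrable_wide_gaussian:
  assumes "r > 0"
  shows "integrable lborel (\<lambda>x::'a::euclidean_space. exp (- (norm (r *\<^sub>R x))\<^sup>2 / 2))"
proof -
  have eq: "exp (- (norm y)\<^sup>2 / 2) = (2 * pi) powr (real DIM('a) / 2) * gauss y" for y :: 'a
    by (simp add: gauss_def powr_minus field_simps)
  have "integrable lborel (\<lambda>x::'a. gauss (r *\<^sub>R x))"
    using integrable_gauss[where 'a='a] \<open>r > 0\<close>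
    by (subst (asm) lborel_affine[of r 0])
       (simp_all add: integrable_density integrable_distr_eq)
  then show ?thesis unfolding eq by simp
qed

lemma integral_mult_gauss_kernel:
  fixes f :: "'a::euclidean_space \<Rightarrow> complex"
  assumes [measurable]: "f \<in> borel_measurable borel" and "r > 0"
  shows "(LINT y|lborel. f y * gauss_kernel r (x - y)) = (LINT z|lborel. gauss z * f (x + r *\<^sub>R z))"
proof -
  have [measurable]: "(gauss_kernel r :: 'a \<Rightarrow> real) \<in> borel_measurable borel"
    unfolding gauss_kernel_def by measurable
  have "(LINT y|lborel. f y * gauss_kernel r (x - y))
      = r ^ DIM('a) *\<^sub>R (LINT z|lborel. f (x + r *\<^sub>R z) * gauss_kernel r (- (r *\<^sub>R z)))"
    using \<open>r > 0\<close> by (subst integral_lborel_affine[of _ r x]) (simp_all)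
  also have "\<dots> = (LINT z|lborel. r ^ DIM('a) *\<^sub>R (f (x + r *\<^sub>R z) * gauss_kernel r (- (r *\<^sub>R z))))"
    by simp
  also have "\<dots> = (LINT z|lborel. gauss z * f (x + r *\<^sub>R z))"
    using \<open>r > 0\<close>
    by (intro Bochner_Integration.integral_cong)
       (simp_all add: gauss_kernel_def scaleR_conv_of_real gauss_minus)
  finally show ?thesis .
qed

lemma integrable_bounded_mult:
  fixes f g :: "'a \<Rightarrow> complex"
  assumes "integrable M f" "g \<in> borel_measurable M" "\<And>x. norm (g x) \<le> B"
  shows "integrable M (\<lambda>x. g x * f x)"
proof (rule Bochner_Integration.integrable_bound)
  show "integrable M (\<lambda>x. B *\<^sub>R f x)"
    using assms(1) by simp
  have "0 \<le> B" using assms(3) norm_ge_zero order_trans by blast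
  then show "AE x in M. norm (g x * f x) \<le> norm (B *\<^sub>R f x)"
    using assms(3) by (auto simp: norm_mult intro!: mult_right_mono)
  show "(\<lambda>x. g x * f x) \<in> borel_measurable M"
    using assms(1,2) by simp
qed

lemma integrable_lborel_pair_times:
  fixes f g :: "'a::euclidean_space \<Rightarrow> complex"
  assumes f: "integrable lborel f" and g: "integrable lborel g"
    and k[measurable]: "case_prod k \<in> borel_measurable (lborel \<Otimes>\<^sub>M lborel)"
    and k1: "\<And>x y. norm (k x y) \<le> 1"
  shows "integrable (lborel \<Otimes>\<^sub>M lborel) (\<lambda>(x, y). k x y * (f x * g y))"
proof -
  have [measurable]: "f \<in> borel_measurable borel" "g \<in> borel_measurable borel"
    using f g by (auto simp: integrable_iff_bounded)
  have "integrable (lborel \<Otimes>\<^sub>M lborel) (\<lambda>(x, y). f x * g y)"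
  proof (rule lborel_pair.Fubini_integrable)
    show "integrable lborel (\<lambda>x. LINT y|lborel. norm (case (x, y) of (x, y) \<Rightarrow> f x * g y))"
      using f g by (simp add: norm_mult)
    show "AE x in lborel. integrable lborel (\<lambda>y. case (x, y) of (x, y) \<Rightarrow> f x * g y)"
      using g by simp
  qed measurable
  from integrable_bounded_mult[OF this k, of 1] show ?thesis
    using k1 by (simp add: split_beta')
qed

text \<open>
  The multiplication formula of Fourier analysis. The sign and scale \<open>s\<close> is a parameter so that the
  formula serves the Fourier transform and its inverse.
\<close>

lemma integral_exp_swap:
  fixes f g :: "'a::euclidean_space \<Rightarrow> complex"
  assumes f: "integrable lborel f" and g: "integrable lborel g"
  shows "(LINT x|lborel. (LINT y|lborel. cis (s * (x \<bullet> y)) * f y) * g x)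
       = (LINT y|lborel. f y * (LINT x|lborel. cis (s * (x \<bullet> y)) * g x))"
proof -
  have "integrable (lborel \<Otimes>\<^sub>M lborel) (\<lambda>(y, x). cis (s * (x \<bullet> y)) * (f y * g x))"
    by (rule integrable_lborel_pair_times[OF f g]) simp_all
  from lborel_pair.Fubini_integral[OF this]
  show ?thesis
    unfolding integral_mult_left_zero[symmetric] integral_mult_right_zero[symmetric]
    by (simp only: mult.assoc mult.left_commute)
qed

definition inv_fourier :: "('a::euclidean_space \<Rightarrow> complex) \<Rightarrow> 'a \<Rightarrow> complex" where
  "inv_fourier f x = (2 * pi) powr (- real DIM('a) / 2) *\<^sub>R (LINT \<xi>|lborel. cis (x \<bullet> \<xi>) * f \<xi>)"

lemma fourier_eq_cnj_inv_fourier: "fourier f x = cnj (inv_fourier (\<lambda>\<xi>. cnj (f \<xi>)) x)"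
proof -
  have "(\<lambda>\<xi>. cis (- (\<xi> \<bullet> x)) * f \<xi>) = (\<lambda>\<xi>. cnj (cis (x \<bullet> \<xi>) * cnj (f \<xi>)))"
    by (auto simp: cis_cnj inner_commute)
  then show ?thesis
    unfolding fourier_def inv_fourier_def by (simp only: Bochner_Integration.integral_cnj complex_cnj_scaleR)
qed

lemma borel_measurable_inv_fourier [measurable]:
  assumes [measurable]: "f \<in> borel_measurable lborel"
  shows "inv_fourier f \<in> borel_measurable lborel"
  unfolding inv_fourier_def by measurable

lemma borel_measurable_fourier [measurable]:
  assumes [measurable]: "f \<in> borel_measurable lborel"
  shows "fourier f \<in> borel_measurable lborel"
  unfolding fourier_def by measurable

lemma norm_fourier_integral_le:
  "norm (LINT y|lborel. cis (s y) * f y) \<le> (LINT y|lborel. norm (f y))"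
  by (rule order_trans[OF integral_norm_bound]) (simp add: norm_mult)

text \<open>
  Without the Gaussian factor the left-hand side need not converge absolutely. With it, the
  multiplication formula may be applied twice, once to \<open>h\<close> and once to \<open>f\<close>, until the integral over
  \<open>x\<close> is the Fourier transform of the Gaussian at \<open>\<xi> - y\<close>, that is, a narrow Gaussian kernel. The
  substitution \<open>y = \<xi> + r z\<close> then moves the parameter \<open>r\<close> from the kernel into the argument of \<open>f\<close>.
\<close>

lemma parseval_regularized:
  fixes f h :: "'a::euclidean_space \<Rightarrow> complex"
  assumes f: "integrable lborel f" and h: "integrable lborel h" and "r > 0"
  shows "(LINT x|lborel. inv_fourier h x * fourier f x * complex_of_real (exp (- (norm (r *\<^sub>R x))\<^sup>2 / 2)))
       = (LINT \<xi>|lborel. h \<xi> * (LINT z|lborel. gauss z * f (\<xi> + r *\<^sub>R z)))"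
proof -
  have [measurable]: "f \<in> borel_measurable borel" "h \<in> borel_measurable borel"
    using f h by (auto simp: integrable_iff_bounded)
  define E where "E x = complex_of_real (exp (- (norm (r *\<^sub>R x))\<^sup>2 / 2))" for x :: 'a
  define Ff where "Ff x = (LINT y|lborel. cis (- 1 * (x \<bullet> y)) * f y)" for x
  define c where "c = (2 * pi) ^ DIM('a)"
  have c: "c > 0" by (simp add: c_def)
  have E_int: "integrable lborel E"
    unfolding E_def using integrable_wide_gaussian[OF \<open>r > 0\<close>] by (rule integrable_of_real)
  have [measurable]: "E \<in> borel_measurable borel" "Ff \<in> borel_measurable borel"
    unfolding E_def Ff_def by measurable
  have "norm (Ff x) \<le> (LINT y|lborel. norm (f y))" for x
    unfolding Ff_def by (rule norm_fourier_integral_le)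
  from integrable_bounded_mult[OF E_int _ this]
  have FfE: "integrable lborel (\<lambda>x. Ff x * E x)" by simp
  have inner: "(LINT x|lborel. cis (1 * (x \<bullet> \<xi>)) * (Ff x * E x))
      = c * (LINT z|lborel. gauss z * f (\<xi> + r *\<^sub>R z))" for \<xi>
  proof -
    have cE: "integrable lborel (\<lambda>x. cis (x \<bullet> \<xi>) * E x)"
      by (rule integrable_bounded_mult[OF E_int, where B = 1]) simp_all
    have "(LINT x|lborel. cis (1 * (x \<bullet> \<xi>)) * (Ff x * E x))
        = (LINT x|lborel. Ff x * (cis (x \<bullet> \<xi>) * E x))"
      by (simp add: mult_ac)
    also have "\<dots> = (LINT y|lborel. f y * (LINT x|lborel. cis (- 1 * (x \<bullet> y)) * (cis (x \<bullet> \<xi>) * E x)))"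
      unfolding Ff_def by (rule integral_exp_swap[OF f cE])
    also have "\<dots> = (LINT y|lborel. c * (f y * gauss_kernel r (\<xi> - y)))"
    proof (rule Bochner_Integration.integral_cong[OF refl])
      fix y
      have "(LINT x|lborel. cis (- 1 * (x \<bullet> y)) * (cis (x \<bullet> \<xi>) * E x))
          = (LINT x|lborel. cis (x \<bullet> (\<xi> - y)) * complex_of_real (exp (- (norm (r *\<^sub>R x))\<^sup>2 / 2)))"
        by (simp add: E_def cis_mult inner_diff_right mult.assoc[symmetric] add.commute)
      also have "\<dots> = c * gauss_kernel r (\<xi> - y)"
        unfolding fourier_wide_gaussian[OF \<open>r > 0\<close>] c_def by simp
      finally show "f y * (LINT x|lborel. cis (- 1 * (x \<bullet> y)) * (cis (x \<bullet> \<xi>) * E x))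
          = c * (f y * gauss_kernel r (\<xi> - y))" by simp
    qed
    also have "\<dots> = c * (LINT z|lborel. gauss z * f (\<xi> + r *\<^sub>R z))"
      using \<open>r > 0\<close> by (simp add: integral_mult_gauss_kernel)
    finally show ?thesis .
  qed
  define d where "d = (2 * pi) powr (- real DIM('a) / 2)"
  have "d * d = (2 * pi) powr (- real DIM('a))"
    unfolding d_def powr_add[symmetric] by simp
  also have "\<dots> = 1 / c"
    by (simp add: c_def powr_minus_divide powr_realpow[of "2 * pi"])
  finally have d: "complex_of_real d * complex_of_real d = complex_of_real (1 / c)"
    unfolding of_real_mult[symmetric] by simp
  have "(LINT x|lborel. inv_fourier h x * fourier f x * E x)
      = (LINT x|lborel. complex_of_real (1 / c)
          * ((LINT \<xi>|lborel. cis (1 * (x \<bullet> \<xi>)) * h \<xi>) * (Ff x * E x)))"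
  proof (rule Bochner_Integration.integral_cong[OF refl])
    fix x
    have "inv_fourier h x = complex_of_real d * (LINT \<xi>|lborel. cis (1 * (x \<bullet> \<xi>)) * h \<xi>)"
      by (simp add: inv_fourier_def d_def scaleR_conv_of_real)
    moreover have "fourier f x = complex_of_real d * Ff x"
      by (simp add: fourier_def Ff_def d_def scaleR_conv_of_real inner_commute)
    ultimately show "inv_fourier h x * fourier f x * E x
        = complex_of_real (1 / c) * ((LINT \<xi>|lborel. cis (1 * (x \<bullet> \<xi>)) * h \<xi>) * (Ff x * E x))"
      unfolding d[symmetric] by (simp only: mult_ac)
  qed
  also have "\<dots> = 1 / c * (LINT \<xi>|lborel. h \<xi> * (LINT x|lborel. cis (1 * (x \<bullet> \<xi>)) * (Ff x * E x)))"
    using integral_exp_swap[OF h FfE, of 1] by simp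
  also have "\<dots> = (LINT \<xi>|lborel. h \<xi> * (LINT z|lborel. gauss z * f (\<xi> + r *\<^sub>R z)))"
  proof -
    have "(LINT \<xi>|lborel. h \<xi> * (c * (LINT z|lborel. gauss z * f (\<xi> + r *\<^sub>R z))))
        = c * (LINT \<xi>|lborel. h \<xi> * (LINT z|lborel. gauss z * f (\<xi> + r *\<^sub>R z)))"
      by (simp only: mult.left_commute[of "h _"] integral_mult_right_zero)
    then show ?thesis unfolding inner using c by simp
  qed
  finally show ?thesis unfolding E_def .
qed

section \<open>The inequality of Bessel\<close>

text \<open>
  The square of the \<open>L\<^sup>2\<close> norm with values in the extended half-line, for arguments in which
  integrability is not yet known.
\<close>

definition L2_sq :: "('a::euclidean_space \<Rightarrow> complex) \<Rightarrow> ennreal" where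
  "L2_sq f = (\<integral>\<^sup>+x. ennreal ((norm (f x))\<^sup>2) \<partial>lborel)"

lemma L2_iff_L2_sq: "f \<in> L2 \<longleftrightarrow> f \<in> borel_measurable lborel \<and> L2_sq f < \<infinity>"
  by (auto simp: L2_def L2_sq_def integrable_iff_bounded)

lemma L2_sq_eq_L2_norm: "f \<in> L2 \<Longrightarrow> L2_sq f = ennreal ((L2_norm f)\<^sup>2)"
  by (simp add: L2_def L2_sq_def L2_norm_def nn_integral_eq_integral integral_nonneg_AE)

lemma L2_norm_le_of_L2_sq_le:
  assumes "f \<in> borel_measurable lborel" "L2_sq f \<le> ennreal (B\<^sup>2)" "0 \<le> B"
  shows "f \<in> L2" "L2_norm f \<le> B"
proof -
  show "f \<in> L2"
    using assms by (auto simp: L2_iff_L2_sq intro: le_less_trans)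
  then have "(L2_norm f)\<^sup>2 \<le> B\<^sup>2"
    using assms(2) by (simp add: L2_sq_eq_L2_norm)
  then show "L2_norm f \<le> B"
    using \<open>0 \<le> B\<close> by (rule power2_le_imp_le)
qed

text \<open>
  Fatou's lemma as lower semicontinuity: bounds on integrals pass to almost everywhere limits.
\<close>

lemma nn_integral_le_of_AE_tendsto:
  fixes u :: "nat \<Rightarrow> 'a \<Rightarrow> ennreal"
  assumes "\<And>k. u k \<in> borel_measurable M"
    and lim: "AE x in M. (\<lambda>k. u k x) \<longlonglongrightarrow> v x"
    and le: "\<forall>\<^sub>F k in sequentially. (\<integral>\<^sup>+x. u k x \<partial>M) \<le> B"
  shows "(\<integral>\<^sup>+x. v x \<partial>M) \<le> B"
proof -
  have "(\<integral>\<^sup>+x. v x \<partial>M) = (\<integral>\<^sup>+x. liminf (\<lambda>k. u k x) \<partial>M)"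
  proof (rule nn_integral_cong_AE)
    show "AE x in M. v x = liminf (\<lambda>k. u k x)"
      using lim by eventually_elim (rule lim_imp_Liminf[symmetric], simp_all)
  qed
  also have "\<dots> \<le> liminf (\<lambda>k. \<integral>\<^sup>+x. u k x \<partial>M)"
    by (rule nn_integral_liminf) fact
  also have "\<dots> \<le> liminf (\<lambda>k::nat. B)"
    by (rule Liminf_mono) fact
  finally show ?thesis by (simp add: Liminf_const)
qed

lemma norm_integral_le_nn_integral:
  fixes f :: "'a \<Rightarrow> 'b::{banach, second_countable_topology}"
  shows "ennreal (norm (integral\<^sup>L M f)) \<le> (\<integral>\<^sup>+x. ennreal (norm (f x)) \<partial>M)"
  by (cases "integrable M f") (simp_all add: integral_norm_bound_ennreal not_integrable_integral_eq)

lemma L2_sq_shift: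
  assumes [measurable]: "h \<in> borel_measurable borel"
  shows "L2_sq (\<lambda>x. h (x + a)) = L2_sq h"
  unfolding L2_sq_def
  by (subst (2) lborel_distr_plus[of a, symmetric]) (simp add: nn_integral_distr add.commute)

lemma nn_integral_norm_mult_le:
  assumes [measurable]: "f \<in> borel_measurable borel" "g \<in> borel_measurable borel"
    and "L2_sq g = L2_sq f"
  shows "(\<integral>\<^sup>+x. ennreal (norm (f x) * norm (g x)) \<partial>lborel) \<le> L2_sq f"
proof -
  have le: "norm (f x) * norm (g x) \<le> 1 / 2 * (norm (f x))\<^sup>2 + 1 / 2 * (norm (g x))\<^sup>2" for x
    using sum_squares_bound[of "norm (f x)" "norm (g x)"] by simp
  have half: "ennreal (1 / 2 * c + 1 / 2 * d) = ennreal (1 / 2) * ennreal c + ennreal (1 / 2) * ennreal d"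
    if "0 \<le> c" "0 \<le> d" for c d :: real
  proof -
    have "0 \<le> 1 / 2 * c" "0 \<le> 1 / 2 * d" "0 \<le> (1 / 2 :: real)" using that by simp_all
    then show ?thesis
      using that by (simp only: ennreal_plus ennreal_mult)
  qed
  have "(\<integral>\<^sup>+x. ennreal (norm (f x) * norm (g x)) \<partial>lborel)
      \<le> (\<integral>\<^sup>+x. ennreal (1 / 2) * ennreal ((norm (f x))\<^sup>2) + ennreal (1 / 2) * ennreal ((norm (g x))\<^sup>2) \<partial>lborel)"
  proof (rule nn_integral_mono)
    fix x
    show "ennreal (norm (f x) * norm (g x))
        \<le> ennreal (1 / 2) * ennreal ((norm (f x))\<^sup>2) + ennreal (1 / 2) * ennreal ((norm (g x))\<^sup>2)"
      unfolding half[OF zero_le_power2 zero_le_power2, symmetric] by (rule ennreal_leI[OF le])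
  qed
  also have "\<dots> = ennreal (1 / 2) * L2_sq f + ennreal (1 / 2) * L2_sq g"
    unfolding L2_sq_def by (subst nn_integral_add) (simp_all add: nn_integral_cmult)
  also have "\<dots> = (ennreal (1 / 2) + ennreal (1 / 2)) * L2_sq f"
    by (simp only: \<open>L2_sq g = L2_sq f\<close> distrib_right)
  also have "\<dots> = L2_sq f"
  proof -
    have "ennreal (1 / 2) + ennreal (1 / 2) = ennreal (1 / 2 + 1 / 2)"
      by (rule ennreal_plus[symmetric]) simp_all
    also have "\<dots> = 1" by simp
    finally show ?thesis by (simp only: mult_1)
  qed
  finally show ?thesis .
qed

lemma norm_inv_fourier_le:
  fixes h :: "'a::euclidean_space \<Rightarrow> complex"
  shows "norm (inv_fourier h x) \<le> (2 * pi) powr (- real DIM('a) / 2) * (LINT \<xi>|lborel. norm (h \<xi>))"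
  using norm_fourier_integral_le[of "\<lambda>\<xi>. x \<bullet> \<xi>" h]
  by (simp add: inv_fourier_def mult_left_mono)

text \<open>
  Take \<open>f\<close> to be the complex conjugate of \<open>h\<close> in the regularized Parseval identity. Its left-hand side
  becomes the integral of \<open>|inv_fourier h|\<^sup>2\<close> against a Gaussian, and its right-hand side is an average,
  with the weight \<open>gauss\<close>, of correlations of \<open>h\<close> with its translates, each at most \<open>L2_sq h\<close>. As \<open>r\<close>
  tends to 0 the Gaussian on the left tends to 1, and Fatou's lemma applies.
\<close>

lemma bessel_inv_fourier:
  fixes h :: "'a::euclidean_space \<Rightarrow> complex"
  assumes h: "integrable lborel h"
  shows "L2_sq (inv_fourier h) \<le> L2_sq h"
proof -
  have [measurable]: "h \<in> borel_measurable borel"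
    using h by (auto simp: integrable_iff_bounded)
  define w where "w = inv_fourier h"
  have [measurable]: "w \<in> borel_measurable borel"
    using borel_measurable_inv_fourier[of h] by (simp add: w_def)
  obtain B where B: "\<And>x. norm (w x) \<le> B"
    unfolding w_def using norm_inv_fourier_le by blast
  define E where "E r x = exp (- (norm (r *\<^sub>R x))\<^sup>2 / 2)" for r :: real and x :: 'a
  have [measurable]: "E r \<in> borel_measurable borel" for r
    unfolding E_def by measurable
  have main: "(\<integral>\<^sup>+x. ennreal ((norm (w x))\<^sup>2 * E r x) \<partial>lborel) \<le> L2_sq h" if "r > 0" for r
  proof -
    have int: "integrable lborel (\<lambda>x. (norm (w x))\<^sup>2 * E r x)"
    proof (rule Bochner_Integration.integrable_bound)
      show "integrable lborel (\<lambda>x. B\<^sup>2 * E r x)"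
        unfolding E_def by (rule integrable_mult_right[OF integrable_wide_gaussian[OF that]])
      show "AE x in lborel. norm ((norm (w x))\<^sup>2 * E r x) \<le> norm (B\<^sup>2 * E r x)"
        using B by (auto simp: E_def abs_mult intro!: mult_right_mono power_mono)
    qed simp
    let ?I = "\<lambda>\<xi>. LINT z|lborel. gauss z * cnj (h (\<xi> + r *\<^sub>R z))"
    have "complex_of_real (LINT x|lborel. (norm (w x))\<^sup>2 * E r x)
        = (LINT x|lborel. inv_fourier h x * fourier (\<lambda>\<xi>. cnj (h \<xi>)) x
              * complex_of_real (exp (- (norm (r *\<^sub>R x))\<^sup>2 / 2)))"
      unfolding integral_complex_of_real[symmetric]
      by (intro Bochner_Integration.integral_cong refl)
         (simp add: fourier_eq_cnj_inv_fourier w_def E_def complex_norm_square[symmetric])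
    also have "\<dots> = (LINT \<xi>|lborel. h \<xi> * ?I \<xi>)"
      using h that by (intro parseval_regularized) simp_all
    finally have eq: "complex_of_real (LINT x|lborel. (norm (w x))\<^sup>2 * E r x) = (LINT \<xi>|lborel. h \<xi> * ?I \<xi>)" .
    have "(\<integral>\<^sup>+x. ennreal ((norm (w x))\<^sup>2 * E r x) \<partial>lborel) = ennreal (LINT x|lborel. (norm (w x))\<^sup>2 * E r x)"
      by (rule nn_integral_eq_integral[OF int]) (simp add: E_def)
    also have "\<dots> \<le> ennreal (norm (LINT \<xi>|lborel. h \<xi> * ?I \<xi>))"
      unfolding eq[symmetric] by (intro ennreal_leI) simp
    also have "ennreal (norm (LINT \<xi>|lborel. h \<xi> * ?I \<xi>)) \<le> (\<integral>\<^sup>+\<xi>. ennreal (norm (h \<xi> * ?I \<xi>)) \<partial>lborel)"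
      by (rule norm_integral_le_nn_integral)
    also have "\<dots> \<le> (\<integral>\<^sup>+\<xi>. (\<integral>\<^sup>+z. ennreal (gauss z) * ennreal (norm (h \<xi>) * norm (h (\<xi> + r *\<^sub>R z))) \<partial>lborel) \<partial>lborel)"
    proof (rule nn_integral_mono)
      fix \<xi>
      have "ennreal (norm (?I \<xi>)) \<le> (\<integral>\<^sup>+z. ennreal (norm (gauss z * cnj (h (\<xi> + r *\<^sub>R z)))) \<partial>lborel)"
        by (rule norm_integral_le_nn_integral)
      then have "ennreal (norm (h \<xi>)) * ennreal (norm (?I \<xi>))
          \<le> ennreal (norm (h \<xi>)) * (\<integral>\<^sup>+z. ennreal (norm (gauss z * cnj (h (\<xi> + r *\<^sub>R z)))) \<partial>lborel)"
        by (rule mult_left_mono) simp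
      also have "\<dots> = (\<integral>\<^sup>+z. ennreal (gauss z) * ennreal (norm (h \<xi>) * norm (h (\<xi> + r *\<^sub>R z))) \<partial>lborel)"
        by (subst nn_integral_cmult[symmetric])
           (auto simp: norm_mult gauss_nonneg ennreal_mult mult_ac intro!: nn_integral_cong)
      finally show "ennreal (norm (h \<xi> * ?I \<xi>)) \<le> \<dots>"
        by (simp add: norm_mult ennreal_mult)
    qed
    also have "\<dots> = (\<integral>\<^sup>+z. (\<integral>\<^sup>+\<xi>. ennreal (gauss z) * ennreal (norm (h \<xi>) * norm (h (\<xi> + r *\<^sub>R z))) \<partial>lborel) \<partial>lborel)"
      by (rule lborel_pair.Fubini'[symmetric]) simp
    also have "\<dots> \<le> (\<integral>\<^sup>+z. ennreal (gauss (z::'a)) * L2_sq h \<partial>lborel)"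
    proof (rule nn_integral_mono)
      fix z
      have "(\<integral>\<^sup>+\<xi>. ennreal (norm (h \<xi>) * norm (h (\<xi> + r *\<^sub>R z))) \<partial>lborel) \<le> L2_sq h"
        by (rule nn_integral_norm_mult_le) (simp_all add: L2_sq_shift)
      then show "(\<integral>\<^sup>+\<xi>. ennreal (gauss z) * ennreal (norm (h \<xi>) * norm (h (\<xi> + r *\<^sub>R z))) \<partial>lborel)
          \<le> ennreal (gauss z) * L2_sq h"
        by (subst nn_integral_cmult) (simp_all add: mult_left_mono)
    qed
    also have "\<dots> = (\<integral>\<^sup>+z. ennreal (gauss (z::'a)) \<partial>lborel) * L2_sq h"
      by (simp add: nn_integral_multc)
    also have "(\<integral>\<^sup>+z. ennreal (gauss (z::'a)) \<partial>lborel) = 1"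
      by (simp add: nn_integral_eq_integral integrable_gauss gauss_nonneg integral_gauss)
    finally show ?thesis by simp
  qed
  show ?thesis
    unfolding w_def[symmetric] L2_sq_def[of w]
  proof (rule nn_integral_le_of_AE_tendsto)
    show "AE x in lborel. (\<lambda>k. ennreal ((norm (w x))\<^sup>2 * E (1 / Suc k) x)) \<longlonglongrightarrow> ennreal ((norm (w x))\<^sup>2)"
    proof (intro AE_I2 tendsto_ennrealI)
      fix x
      have "(\<lambda>k. (norm (w x))\<^sup>2 * E (1 / Suc k) x) \<longlonglongrightarrow> (norm (w x))\<^sup>2 * exp (- (norm (0 *\<^sub>R x))\<^sup>2 / 2)"
        unfolding E_def by (intro tendsto_intros LIMSEQ_Suc[OF lim_1_over_n]) simp
      then show "(\<lambda>k. (norm (w x))\<^sup>2 * E (1 / Suc k) x) \<longlonglongrightarrow> (norm (w x))\<^sup>2"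
        by simp
    qed
    show "\<forall>\<^sub>F k in sequentially. (\<integral>\<^sup>+x. ennreal ((norm (w x))\<^sup>2 * E (1 / Suc k) x) \<partial>lborel) \<le> L2_sq h"
      by (intro always_eventually allI main) simp
  qed simp
qed

lemma L2_sq_cnj: "L2_sq (\<lambda>x. cnj (f x)) = L2_sq f"
  by (simp add: L2_sq_def)

lemma bessel_fourier:
  assumes "integrable lborel f"
  shows "L2_sq (fourier f) \<le> L2_sq f"
  using bessel_inv_fourier[of "\<lambda>x. cnj (f x)"] assms
  unfolding fourier_eq_cnj_inv_fourier[abs_def] L2_sq_cnj by simp

text \<open>
  Integrated, this serves in place of the Cauchy-Schwarz inequality: a large weight \<open>s\<close> exploits that
  the first factor is small.
\<close>

lemma norm_mult_le_weighted_squares: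
  fixes a b :: complex
  assumes "s > 0"
  shows "norm (a * b) \<le> s * (norm a)\<^sup>2 + (norm b)\<^sup>2 / s"
proof -
  have "0 \<le> (s * norm a - norm b)\<^sup>2 + (s * norm a)\<^sup>2 + (norm b)\<^sup>2" by simp
  then have "s * (norm a * norm b) \<le> s * (s * (norm a)\<^sup>2 + (norm b)\<^sup>2 / s)"
    using assms by (simp add: power2_eq_square algebra_simps)
  then show ?thesis
    using assms by (simp add: norm_mult)
qed

lemma L2_mult_integrable:
  assumes "f \<in> L2" "g \<in> L2"
  shows "integrable lborel (\<lambda>x. f x * g x)"
proof (rule Bochner_Integration.integrable_bound)
  show "integrable lborel (\<lambda>x. 1 * (norm (f x))\<^sup>2 + (norm (g x))\<^sup>2 / 1)"
    using assms by (simp add: L2_def)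
  show "AE x in lborel. norm (f x * g x) \<le> norm (1 * (norm (f x))\<^sup>2 + (norm (g x))\<^sup>2 / 1)"
    by (rule AE_I2, rule order_trans[OF norm_mult_le_weighted_squares[of 1]]) simp_all
  show "(\<lambda>x. f x * g x) \<in> borel_measurable lborel"
    using assms by (intro borel_measurable_times) (simp_all add: L2_def)
qed

lemma norm_integral_mult_le_weighted:
  assumes "f \<in> L2" "g \<in> L2" "s > 0"
  shows "norm (LINT x|lborel. f x * g x) \<le> s * (L2_norm f)\<^sup>2 + (L2_norm g)\<^sup>2 / s"
proof -
  have int: "integrable lborel (\<lambda>x. (norm (f x))\<^sup>2)" "integrable lborel (\<lambda>x. (norm (g x))\<^sup>2)"
    using assms by (auto simp: L2_def)
  have "norm (LINT x|lborel. f x * g x) \<le> (LINT x|lborel. norm (f x * g x))"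
    by (rule integral_norm_bound)
  also have "\<dots> \<le> (LINT x|lborel. s * (norm (f x))\<^sup>2 + (norm (g x))\<^sup>2 / s)"
    using int assms L2_mult_integrable[OF assms(1,2)]
    by (intro integral_mono norm_mult_le_weighted_squares) simp_all
  also have "\<dots> = s * (L2_norm f)\<^sup>2 + (L2_norm g)\<^sup>2 / s"
    using int by (simp add: L2_norm_def integral_nonneg_AE)
  finally show ?thesis .
qed

lemma
  fixes f :: "'a::euclidean_space \<Rightarrow> complex"
  assumes f: "continuous_on UNIV f" and K: "compact K" "\<And>x. x \<notin> K \<Longrightarrow> f x = 0"
  shows integrable_continuous_compact_support: "integrable lborel f"
    and L2_continuous_compact_support: "f \<in> L2"
    and bounded_continuous_compact_support: "\<exists>B. \<forall>x. norm (f x) \<le> B"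
proof -
  have ind: "indicator K x *\<^sub>R f x = f x" for x
    using K(2) by (auto simp: indicator_def)
  show int: "integrable lborel f"
    using borel_integrable_compact[OF K(1), of f] continuous_on_subset[OF f, of K]
    unfolding ind by simp
  have "bounded (f ` K)"
    using continuous_on_subset[OF f, of K] K(1)
    by (intro compact_imp_bounded compact_continuous_image) auto
  then obtain B where B: "\<forall>y\<in>f ` K. norm y \<le> B" unfolding bounded_iff by blast
  have bd: "norm (f x) \<le> max 0 B" for x
    using B K(2)[of x] by (cases "x \<in> K") auto
  then show "\<exists>B. \<forall>x. norm (f x) \<le> B" by blast
  have "integrable lborel (\<lambda>x. norm (f x) * norm (f x))"
  proof (rule Bochner_Integration.integrable_bound)
    show "integrable lborel (\<lambda>x. max 0 B * norm (f x))" using int by simp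
    show "AE x in lborel. norm (norm (f x) * norm (f x)) \<le> norm (max 0 B * norm (f x))"
      using bd by (auto simp: abs_mult intro!: mult_right_mono)
  qed (use int in simp)
  then show "f \<in> L2"
    using int by (simp add: L2_def power2_eq_square borel_measurable_integrable)
qed

section \<open>Inverse Fourier transforms of square-integrable functions\<close>

lemma L2_of_integrable_bessel:
  assumes "h \<in> L2" "integrable lborel h"
  shows "inv_fourier h \<in> L2" "fourier h \<in> L2"
  using assms bessel_inv_fourier[of h] bessel_fourier[of h]
  by (auto simp: L2_iff_L2_sq borel_measurable_inv_fourier borel_measurable_fourier
      simp del: measurable_lborel1 intro: le_less_trans)

text \<open>
  Both sides of the regularized Parseval identity converge as \<open>r\<close> tends to 0: the left-hand side
  because \<open>inv_fourier h\<close> and \<open>fourier f\<close> are square-integrable by Bessel's inequality, the right-hand side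
  because \<open>f\<close> is bounded and continuous, so that its Gaussian averages converge to it boundedly.
\<close>

lemma parseval_inv_fourier:
  fixes f h :: "'a::euclidean_space \<Rightarrow> complex"
  assumes h: "integrable lborel h" "h \<in> L2"
    and f: "continuous_on UNIV f" and K: "compact K" "\<And>x. x \<notin> K \<Longrightarrow> f x = 0"
  shows "(LINT x|lborel. inv_fourier h x * fourier f x) = (LINT \<xi>|lborel. h \<xi> * f \<xi>)"
proof -
  have f_int: "integrable lborel f"
    using f K by (rule integrable_continuous_compact_support)
  have f_L2: "f \<in> L2"
    using f K by (rule L2_continuous_compact_support)
  obtain B where B: "\<And>x. norm (f x) \<le> B"
    using bounded_continuous_compact_support[OF f K] by blast
  have [measurable]: "f \<in> borel_measurable borel" "h \<in> borel_measurable borel"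
    using f_int h by (auto simp: integrable_iff_bounded)
  have [measurable]: "fourier f \<in> borel_measurable borel" "inv_fourier h \<in> borel_measurable borel"
    using borel_measurable_fourier[of f] borel_measurable_inv_fourier[of h] by simp_all
  define E where "E k x = complex_of_real (exp (- (norm ((1 / Suc k) *\<^sub>R x))\<^sup>2 / 2))" for k and x :: 'a
  have [measurable]: "E k \<in> borel_measurable borel" for k
    unfolding E_def by measurable
  define I where "I k \<xi> = (LINT z|lborel. gauss z * f (\<xi> + (1 / Suc k) *\<^sub>R z))" for k \<xi>
  have [measurable]: "I k \<in> borel_measurable borel" for k
    unfolding I_def by measurable
  have fB: "integrable lborel (\<lambda>z::'a. B * gauss z)"
    by (rule integrable_mult_right[OF integrable_gauss])
  have bd: "norm (complex_of_real (gauss z) * f y) \<le> B * gauss z" for z :: 'a and y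
    using mult_right_mono[OF B[of y] gauss_nonneg[of z]] by (simp add: norm_mult gauss_nonneg mult.commute)
  have "(\<lambda>k. LINT x|lborel. inv_fourier h x * fourier f x * E k x)
      \<longlonglongrightarrow> (LINT x|lborel. inv_fourier h x * fourier f x)"
  proof (rule integral_dominated_convergence)
    show "integrable lborel (\<lambda>x. norm (inv_fourier h x * fourier f x))"
      using L2_of_integrable_bessel[OF h(2,1)] L2_of_integrable_bessel[OF f_L2 f_int]
      by (intro integrable_norm L2_mult_integrable)
    show "AE x in lborel. norm (inv_fourier h x * fourier f x * E k x) \<le> norm (inv_fourier h x * fourier f x)" for k
      by (auto simp: E_def norm_mult intro!: mult_right_le_one_le)
    show "AE x in lborel. (\<lambda>k. inv_fourier h x * fourier f x * E k x) \<longlonglongrightarrow> inv_fourier h x * fourier f x"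
    proof (intro AE_I2)
      fix x
      have "(\<lambda>k. E k x) \<longlonglongrightarrow> complex_of_real (exp (- (norm (0 *\<^sub>R x))\<^sup>2 / 2))"
        unfolding E_def by (intro tendsto_intros LIMSEQ_Suc[OF lim_1_over_n]) simp
      then show "(\<lambda>k. inv_fourier h x * fourier f x * E k x) \<longlonglongrightarrow> inv_fourier h x * fourier f x"
        using tendsto_mult[OF tendsto_const[of "inv_fourier h x * fourier f x"]] by fastforce
    qed
  qed measurable
  moreover have "(LINT x|lborel. inv_fourier h x * fourier f x * E k x) = (LINT \<xi>|lborel. h \<xi> * I k \<xi>)" for k
    unfolding E_def I_def by (rule parseval_regularized[OF f_int h(1)]) simp
  moreover have "(\<lambda>k. LINT \<xi>|lborel. h \<xi> * I k \<xi>) \<longlonglongrightarrow> (LINT \<xi>|lborel. h \<xi> * f \<xi>)"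
  proof (rule integral_dominated_convergence)
    show "integrable lborel (\<lambda>\<xi>. B * norm (h \<xi>))"
      using h by simp
    have "norm (I k \<xi>) \<le> B" for k \<xi>
    proof -
      have "norm (I k \<xi>) \<le> (LINT z|lborel. B * gauss (z::'a))"
        unfolding I_def by (rule order_trans[OF integral_norm_bound integral_mono[OF _ fB bd]])
          (rule integrable_norm, rule Bochner_Integration.integrable_bound[OF fB],
           use order_trans[OF bd abs_ge_self] in \<open>auto\<close>)
      then show ?thesis using integral_gauss[where 'a='a] by simp
    qed
    then show "AE \<xi> in lborel. norm (h \<xi> * I k \<xi>) \<le> B * norm (h \<xi>)" for k
      by (auto simp: norm_mult mult.commute[of "cmod (h _)"] intro!: mult_right_mono)
    show "AE \<xi> in lborel. (\<lambda>k. h \<xi> * I k \<xi>) \<longlonglongrightarrow> h \<xi> * f \<xi>"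
    proof (intro AE_I2 tendsto_mult tendsto_const)
      fix \<xi>
      have "(\<lambda>k. I k \<xi>) \<longlonglongrightarrow> (LINT z|lborel. complex_of_real (gauss (z::'a)) * f \<xi>)"
        unfolding I_def
      proof (rule integral_dominated_convergence[OF _ _ fB])
        show "AE z in lborel. (\<lambda>k. complex_of_real (gauss z) * f (\<xi> + (1 / Suc k) *\<^sub>R z)) \<longlonglongrightarrow> complex_of_real (gauss z) * f \<xi>"
        proof (intro AE_I2 tendsto_mult tendsto_const)
          fix z
          have "(\<lambda>k. \<xi> + (1 / Suc k) *\<^sub>R z) \<longlonglongrightarrow> \<xi> + 0 *\<^sub>R z"
            by (intro tendsto_intros LIMSEQ_Suc[OF lim_1_over_n])
          then show "(\<lambda>k. f (\<xi> + (1 / Suc k) *\<^sub>R z)) \<longlonglongrightarrow> f \<xi>"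
            using f by (intro continuous_on_tendsto_compose[OF f]) simp_all
        qed
        show "AE z in lborel. norm (complex_of_real (gauss z) * f (\<xi> + (1 / Suc k) *\<^sub>R z)) \<le> B * gauss z" for k
          using bd by simp
      qed measurable
      then show "(\<lambda>k. I k \<xi>) \<longlonglongrightarrow> f \<xi>"
        using integral_gauss[where 'a='a] by simp
    qed
  qed measurable
  ultimately show ?thesis
    by (simp only: LIMSEQ_unique)
qed

text \<open>
  The core of the completeness of \<open>L\<^sup>2\<close>. The weights \<open>2 ^ k\<close> are small enough for
  \<open>\<Sum>k. 2 ^ k * |w (Suc k) - w k|\<^sup>2\<close> to be integrable, hence finite almost everywhere, and large enough
  for its finiteness to force the increments to decay geometrically.
\<close>

lemma AE_convergent_of_L2_sq_geometric:
  fixes w :: "nat \<Rightarrow> 'a::euclidean_space \<Rightarrow> complex"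
  assumes [measurable]: "\<And>k. w k \<in> borel_measurable borel"
    and geo: "\<And>k. L2_sq (\<lambda>x. w (Suc k) x - w k x) \<le> ennreal ((1 / 4) ^ k)"
  shows "AE x in lborel. convergent (\<lambda>k. w k x)"
proof -
  define d where "d k x = w (Suc k) x - w k x" for k x
  have [measurable]: "d k \<in> borel_measurable borel" for k
    unfolding d_def by measurable
  define S where "S x = (\<Sum>k. ennreal (2 ^ k) * ennreal ((norm (d k x))\<^sup>2))" for x
  have "(\<integral>\<^sup>+x. S x \<partial>lborel) = (\<Sum>k. ennreal (2 ^ k) * L2_sq (d k))"
    unfolding S_def L2_sq_def by (subst nn_integral_suminf) (simp_all add: nn_integral_cmult)
  also have "\<dots> \<le> (\<Sum>k. ennreal ((1 / 2) ^ k))"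
  proof (rule suminf_le)
    fix k
    have "ennreal (2 ^ k) * L2_sq (d k) \<le> ennreal (2 ^ k) * ennreal ((1 / 4) ^ k)"
      using geo[of k] by (intro mult_left_mono) (simp_all add: d_def[abs_def])
    also have "\<dots> = ennreal (2 ^ k * (1 / 4) ^ k)"
      by (rule ennreal_mult[symmetric]) simp_all
    also have "(2::real) ^ k * (1 / 4) ^ k = (1 / 2) ^ k"
      unfolding power_mult_distrib[symmetric] by simp
    finally show "ennreal (2 ^ k) * L2_sq (d k) \<le> ennreal ((1 / 2) ^ k)" .
  qed simp_all
  also have "\<dots> = ennreal (\<Sum>k. (1 / 2) ^ k)"
    by (rule suminf_ennreal2) (simp_all add: summable_geometric)
  finally have "(\<integral>\<^sup>+x. S x \<partial>lborel) \<le> ennreal (\<Sum>k. (1 / 2) ^ k)" .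
  from neq_top_trans[OF ennreal_neq_top this] have "AE x in lborel. S x \<noteq> \<infinity>"
    unfolding infinity_ennreal_def[symmetric]
    by (intro nn_integral_PInf_AE) (simp_all only: S_def[abs_def], measurable)
  then show ?thesis
  proof eventually_elim
    case (elim x)
    then obtain C where C: "0 \<le> C" "S x = ennreal C"
      by (cases "S x") auto
    have "norm (d k x) \<le> sqrt C * (sqrt (1 / 2)) ^ k" for k
    proof -
      have "ennreal (2 ^ k) * ennreal ((norm (d k x))\<^sup>2) \<le> S x"
        unfolding S_def using sum_le_suminf[OF summableI, of "{k}"] by simp
      then have "ennreal (2 ^ k * (norm (d k x))\<^sup>2) \<le> ennreal C"
        unfolding C(2) by (subst ennreal_mult) simp_all
      then have "2 ^ k * (norm (d k x))\<^sup>2 \<le> C"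
        using C(1) by (simp only: ennreal_le_iff)
      then have "(norm (d k x))\<^sup>2 \<le> C * (1 / 2) ^ k"
        by (simp add: power_one_over pos_le_divide_eq mult.commute)
      then have "norm (d k x) \<le> sqrt (C * (1 / 2) ^ k)"
        by (rule real_le_rsqrt)
      then show ?thesis
        by (simp only: real_sqrt_mult real_sqrt_power)
    qed
    moreover have "summable (\<lambda>k. sqrt C * (sqrt (1 / 2)) ^ k)"
      by (rule summable_mult, rule summable_geometric) simp
    ultimately have "summable (\<lambda>k. d k x)"
      using summable_comparison_test'[of "\<lambda>k. sqrt C * (sqrt (1 / 2)) ^ k" 0 "\<lambda>k. d k x"] by blast
    then have "convergent (\<lambda>n. w 0 x + (\<Sum>k<n. d k x))"
      unfolding summable_iff_convergent by (rule convergent_add[OF convergent_const])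
    moreover have "w 0 x + (\<Sum>k<n. d k x) = w n x" for n
      using sum_lessThan_telescope[of "\<lambda>k. w k x" n] by (simp add: d_def)
    ultimately show ?case by (simp only:)
  qed
qed

text \<open>
  In the weighted inequality the weight \<open>2 ^ k\<close> makes both the term with the squared distance, at most
  \<open>(1 / 4) ^ k\<close>, and the term with the fixed factor \<open>g\<close> of size \<open>(1 / 2) ^ k\<close>.
\<close>

lemma tendsto_integral_mult_of_L2_sq_geometric:
  fixes a :: "nat \<Rightarrow> 'a::euclidean_space \<Rightarrow> complex"
  assumes a: "\<And>k. a k \<in> L2" and A: "A \<in> L2" and g: "g \<in> L2"
    and geo: "\<And>k. L2_sq (\<lambda>x. A x - a k x) \<le> ennreal ((1 / 4) ^ k)"
  shows "(\<lambda>k. LINT x|lborel. a k x * g x) \<longlonglongrightarrow> (LINT x|lborel. A x * g x)"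
proof -
  have "norm ((LINT x|lborel. a k x * g x) - (LINT x|lborel. A x * g x))
      \<le> (1 + (L2_norm g)\<^sup>2) * (1 / 2) ^ k" for k
  proof -
    have "(1 / 4 :: real) ^ k = ((1 / 2) ^ k)\<^sup>2"
      by (simp add: power2_eq_square flip: power_mult_distrib)
    with geo[of k] have "L2_sq (\<lambda>x. A x - a k x) \<le> ennreal (((1 / 2) ^ k)\<^sup>2)" by simp
    moreover have "(\<lambda>x. A x - a k x) \<in> borel_measurable lborel"
      using A a by (intro borel_measurable_diff) (simp_all add: L2_def)
    ultimately have D: "(\<lambda>x. A x - a k x) \<in> L2" "L2_norm (\<lambda>x. A x - a k x) \<le> (1 / 2) ^ k"
      using L2_norm_le_of_L2_sq_le[of "\<lambda>x. A x - a k x" "(1 / 2) ^ k"] by simp_all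
    have "norm (LINT x|lborel. (A x - a k x) * g x)
        \<le> 2 ^ k * (L2_norm (\<lambda>x. A x - a k x))\<^sup>2 + (L2_norm g)\<^sup>2 / 2 ^ k"
      by (rule norm_integral_mult_le_weighted[OF D(1) g]) simp
    also have "\<dots> \<le> 2 ^ k * ((1 / 2) ^ k)\<^sup>2 + (L2_norm g)\<^sup>2 / 2 ^ k"
      using D(2) by (intro add_right_mono mult_left_mono power_mono) (simp_all add: L2_norm_def integral_nonneg_AE)
    also have "\<dots> = (1 + (L2_norm g)\<^sup>2) * (1 / 2) ^ k"
    proof -
      have "t * (1 / t)\<^sup>2 + G / t = (1 + G) * (1 / t)" if "t > 0" for t G :: real
        using that by (simp add: power2_eq_square field_simps)
      from this[of "2 ^ k"] show ?thesis by (simp add: power_one_over)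
    qed
    also have "(LINT x|lborel. (A x - a k x) * g x) = (LINT x|lborel. A x * g x) - (LINT x|lborel. a k x * g x)"
      using L2_mult_integrable[OF A g] L2_mult_integrable[OF a g] by (simp add: left_diff_distrib)
    finally show ?thesis by (simp add: norm_minus_commute)
  qed
  then have bound: "\<forall>\<^sub>F k in sequentially. norm ((LINT x|lborel. a k x * g x) - (LINT x|lborel. A x * g x))
      \<le> (1 + (L2_norm g)\<^sup>2) * (1 / 2) ^ k"
    by (intro always_eventually allI)
  have "(\<lambda>k. (1 + (L2_norm g)\<^sup>2) * (1 / 2) ^ k) \<longlonglongrightarrow> 0"
    by (rule tendsto_mult_right_zero, rule LIMSEQ_power_zero) simp
  from Lim_null_comparison[OF bound this] show ?thesis
    by (rule LIM_zero_cancel)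
qed

text \<open>
  Cut \<open>H\<close> off outside balls that grow fast enough for the squared norms of the tails to be at most
  \<open>(1 / 4) ^ k\<close>. The truncations are integrable, so they have inverse Fourier transforms, which by Bessel's
  inequality form a rapidly converging sequence. Its limit \<open>w\<close> inherits the norm bound by Fatou's lemma
  and the duality with test functions by continuity.
\<close>

theorem L2_inverse_fourier_exists:
  fixes H :: "'a::euclidean_space \<Rightarrow> complex"
  assumes H: "H \<in> L2"
  obtains w where "w \<in> L2" "L2_norm w \<le> L2_norm H"
    "\<forall>f K. continuous_on UNIV f \<longrightarrow> compact K \<longrightarrow> (\<forall>x. x \<notin> K \<longrightarrow> f x = 0) \<longrightarrow>
       (LINT x|lborel. w x * fourier f x) = (LINT \<xi>|lborel. H \<xi> * f \<xi>)"
proof -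
  have [measurable]: "H \<in> borel_measurable borel"
    using H by (simp add: L2_def)
  have H_sq: "L2_sq H < \<infinity>" using H by (simp add: L2_iff_L2_sq)
  \<comment> \<open>the squared norm of the part of \<open>H\<close> outside a ball\<close>
  define \<tau> where "\<tau> R = L2_sq (\<lambda>\<xi>. if R < norm \<xi> then H \<xi> else 0)" for R :: real
  have "(\<lambda>n. \<tau> (real n)) \<longlonglongrightarrow> (\<integral>\<^sup>+x. 0 \<partial>(lborel :: 'a measure))"
    unfolding \<tau>_def L2_sq_def
  proof (rule nn_integral_dominated_convergence)
    show "AE x in lborel. ennreal ((norm (if real n < norm x then H x else 0))\<^sup>2) \<le> ennreal ((norm (H x))\<^sup>2)" for n
      by simp
    show "AE x in lborel. (\<lambda>n. ennreal ((norm (if real n < norm x then H x else 0))\<^sup>2)) \<longlonglongrightarrow> 0"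
    proof (intro AE_I2 tendsto_eventually)
      fix x :: 'a
      obtain N :: nat where "norm x \<le> N" using real_arch_simple by blast
      then show "\<forall>\<^sub>F n in sequentially. ennreal ((norm (if real n < norm x then H x else 0))\<^sup>2) = 0"
        by (auto simp: eventually_sequentially intro!: exI[of _ N])
    qed
  qed (use H_sq in \<open>simp_all add: L2_sq_def\<close>)
  then have "(\<lambda>n. \<tau> (real n)) \<longlonglongrightarrow> 0" by simp
  then have "\<forall>\<^sub>F n in sequentially. \<tau> (real n) < ennreal ((1 / 4) ^ k)" for k
    by (rule order_tendstoD) simp
  then have "\<exists>n::nat. \<tau> (real n) \<le> ennreal ((1 / 4) ^ k)" for k
    unfolding eventually_sequentially by (meson less_imp_le order_refl)
  then obtain N :: "nat \<Rightarrow> nat" where N: "\<And>k. \<tau> (real (N k)) \<le> ennreal ((1 / 4) ^ k)"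
    by metis
  \<comment> \<open>partial sums make the radii increasing, so that the truncations are nested\<close>
  define R where "R k = (\<Sum>i\<le>k. real (N i))" for k
  have R_ge: "real (N k) \<le> R k" for k
    unfolding R_def by (rule member_le_sum) auto
  have R_mono: "R k \<le> R l" if "k \<le> l" for k l
    unfolding R_def using that by (intro sum_mono2) auto
  define h where "h k \<xi> = (if norm \<xi> \<le> R k then H \<xi> else 0)" for k \<xi>
  have [measurable]: "h k \<in> borel_measurable borel" for k
    unfolding h_def by measurable
  have h_sq: "L2_sq (h k) \<le> L2_sq H" for k
    unfolding L2_sq_def h_def by (intro nn_integral_mono) simp
  have h_L2: "h k \<in> L2" for k
    using h_sq[of k] H_sq by (auto simp: L2_iff_L2_sq intro: le_less_trans)
  have h_int: "integrable lborel (h k)" for k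
  proof (rule Bochner_Integration.integrable_bound)
    show "integrable lborel (\<lambda>\<xi>::'a. indicator (cball 0 (R k)) \<xi> + (norm (h k \<xi>))\<^sup>2)"
    proof (rule Bochner_Integration.integrable_add)
      show "integrable lborel (\<lambda>\<xi>::'a. indicator (cball 0 (R k)) \<xi> :: real)"
        by (rule integrable_real_indicator) (use emeasure_lborel_cball_finite in simp_all)
      show "integrable lborel (\<lambda>\<xi>::'a. (norm (h k \<xi>))\<^sup>2)"
        using h_L2[of k] by (simp add: L2_def)
    qed
    show "AE \<xi> in lborel. norm (h k \<xi>) \<le> norm (indicator (cball 0 (R k)) \<xi> + (norm (h k \<xi>))\<^sup>2)"
    proof (rule AE_I2)
      fix \<xi>
      have "norm z \<le> 1 + (norm z)\<^sup>2" for z :: complex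
      proof -
        have "2 * norm z \<le> 1 + (norm z)\<^sup>2"
          using sum_squares_bound[of 1 "norm z"] by simp
        then show ?thesis using norm_ge_zero[of z] by linarith
      qed
      then show "norm (h k \<xi>) \<le> norm (indicator (cball 0 (R k)) \<xi> + (norm (h k \<xi>))\<^sup>2)"
        by (auto simp: h_def indicator_def)
    qed
  qed simp
  have tail: "L2_sq (\<lambda>\<xi>. F \<xi> - h k \<xi>) \<le> ennreal ((1 / 4) ^ k)" if "F = H \<or> (\<exists>l\<ge>k. F = h l)" for F k
  proof -
    have "norm (F \<xi> - h k \<xi>) \<le> norm (if real (N k) < norm \<xi> then H \<xi> else 0)" for \<xi>
    proof (cases "real (N k) < norm \<xi>")
      case True
      then show ?thesis using that by (auto simp: h_def)
    next
      case False
      then have "norm \<xi> \<le> R l" if "k \<le> l" for l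
        using R_ge[of k] R_mono[OF that] by linarith
      then show ?thesis using that by (auto simp: h_def)
    qed
    then have "L2_sq (\<lambda>\<xi>. F \<xi> - h k \<xi>) \<le> \<tau> (real (N k))"
      unfolding L2_sq_def \<tau>_def by (intro nn_integral_mono ennreal_leI power_mono) simp_all
    then show ?thesis using N[of k] by (rule order_trans)
  qed
  define w where "w k = inv_fourier (h k)" for k
  have [measurable]: "w k \<in> borel_measurable borel" for k
    using borel_measurable_inv_fourier[of "h k"] by (simp add: w_def)
  have w_L2: "w k \<in> L2" for k
    unfolding w_def by (rule L2_of_integrable_bessel[OF h_L2 h_int])
  have w_diff: "L2_sq (\<lambda>x. w l x - w k x) \<le> ennreal ((1 / 4) ^ k)" if "k \<le> l" for k l
  proof -
    have "w l x - w k x = inv_fourier (\<lambda>\<xi>. h l \<xi> - h k \<xi>) x" for x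
    proof -
      have "integrable lborel (\<lambda>\<xi>. cis (x \<bullet> \<xi>) * h k \<xi>)" for k
        by (rule integrable_bounded_mult[OF h_int, where B = 1]) simp_all
      then show ?thesis
        by (simp add: w_def inv_fourier_def right_diff_distrib scaleR_right_diff_distrib)
    qed
    then have "L2_sq (\<lambda>x. w l x - w k x) \<le> L2_sq (\<lambda>\<xi>. h l \<xi> - h k \<xi>)"
      using bessel_inv_fourier[of "\<lambda>\<xi>. h l \<xi> - h k \<xi>"] h_int by simp
    also have "\<dots> \<le> ennreal ((1 / 4) ^ k)"
      using that by (intro tail) auto
    finally show ?thesis .
  qed
  define W where "W x = lim (\<lambda>k. w k x)" for x
  have [measurable]: "W \<in> borel_measurable borel"
    unfolding W_def by measurable
  have "AE x in lborel. convergent (\<lambda>k. w k x)"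
    by (rule AE_convergent_of_L2_sq_geometric) (simp_all add: w_diff)
  then have W: "AE x in lborel. (\<lambda>k. w k x) \<longlonglongrightarrow> W x"
    by eventually_elim (simp add: W_def convergent_LIMSEQ_iff)
  have "L2_sq W \<le> L2_sq H"
    unfolding L2_sq_def[of W]
  proof (rule nn_integral_le_of_AE_tendsto)
    show "AE x in lborel. (\<lambda>k. ennreal ((norm (w k x))\<^sup>2)) \<longlonglongrightarrow> ennreal ((norm (W x))\<^sup>2)"
      using W by eventually_elim (intro tendsto_intros)
    show "\<forall>\<^sub>F k in sequentially. (\<integral>\<^sup>+x. ennreal ((norm (w k x))\<^sup>2) \<partial>lborel) \<le> L2_sq H"
      using bessel_inv_fourier[OF h_int] h_sq
      by (intro always_eventually) (auto simp: w_def simp flip: L2_sq_def intro: order_trans)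
  qed simp
  then have W_L2: "W \<in> L2" "L2_norm W \<le> L2_norm H"
    using L2_norm_le_of_L2_sq_le[of W "L2_norm H"] by (simp_all add: L2_sq_eq_L2_norm[OF H] L2_norm_def integral_nonneg_AE)
  have W_diff: "L2_sq (\<lambda>x. W x - w k x) \<le> ennreal ((1 / 4) ^ k)" for k
    unfolding L2_sq_def[of "\<lambda>x. W x - w k x"]
  proof (rule nn_integral_le_of_AE_tendsto)
    show "AE x in lborel. (\<lambda>l. ennreal ((norm (w l x - w k x))\<^sup>2)) \<longlonglongrightarrow> ennreal ((norm (W x - w k x))\<^sup>2)"
      using W by eventually_elim (intro tendsto_intros)
    show "\<forall>\<^sub>F l in sequentially. (\<integral>\<^sup>+x. ennreal ((norm (w l x - w k x))\<^sup>2) \<partial>lborel) \<le> ennreal ((1 / 4) ^ k)"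
      using w_diff[of k] by (auto simp: eventually_sequentially simp flip: L2_sq_def)
  qed simp
  have dual: "(LINT x|lborel. W x * fourier f x) = (LINT \<xi>|lborel. H \<xi> * f \<xi>)"
    if f: "continuous_on UNIV f" "compact K" "\<And>x. x \<notin> K \<Longrightarrow> f x = 0" for f K
  proof -
    have f_L2: "f \<in> L2" "fourier f \<in> L2"
      using L2_continuous_compact_support[OF f] integrable_continuous_compact_support[OF f]
      by (auto intro: L2_of_integrable_bessel)
    have "(\<lambda>k. LINT x|lborel. w k x * fourier f x) \<longlonglongrightarrow> (LINT x|lborel. W x * fourier f x)"
      by (rule tendsto_integral_mult_of_L2_sq_geometric[OF w_L2 W_L2(1) f_L2(2) W_diff])
    moreover have "(\<lambda>k. LINT \<xi>|lborel. h k \<xi> * f \<xi>) \<longlonglongrightarrow> (LINT \<xi>|lborel. H \<xi> * f \<xi>)"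
      by (rule tendsto_integral_mult_of_L2_sq_geometric[OF h_L2 H f_L2(1)]) (simp add: tail)
    moreover have "(LINT x|lborel. w k x * fourier f x) = (LINT \<xi>|lborel. h k \<xi> * f \<xi>)" for k
      unfolding w_def by (rule parseval_inv_fourier[OF h_int h_L2 f])
    ultimately show ?thesis
      by (simp add: LIMSEQ_unique)
  qed
  show thesis
    using W_L2 dual by (intro that) blast+
qed

section \<open>From pointwise bounds on the Fourier side to the estimates\<close>

lemma L2_set_integrable_compact:
  fixes H :: "'a::euclidean_space \<Rightarrow> complex"
  assumes "H \<in> L2" "compact K"
  shows "set_integrable lborel K H"
proof -
  have [measurable]: "K \<in> sets borel"
    using \<open>compact K\<close> by (rule borel_compact)
  have "integrable lborel (\<lambda>x. indicator K x :: real)"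
    using emeasure_bounded_finite[OF compact_imp_bounded[OF \<open>compact K\<close>]] by (intro integrable_real_indicator) simp_all
  moreover have "(\<lambda>x. (norm (indicator K x :: complex))\<^sup>2) = (\<lambda>x. indicator K x :: real)"
    by (auto simp: indicator_def)
  ultimately have "(indicator K :: 'a \<Rightarrow> complex) \<in> L2"
    by (simp add: L2_def)
  from L2_mult_integrable[OF this \<open>H \<in> L2\<close>]
  have "integrable lborel (\<lambda>x. indicator K x * H x)" .
  moreover have "(\<lambda>x. indicator K x * H x) = (\<lambda>x. indicator K x *\<^sub>R H x)"
    by (auto simp: indicator_def)
  ultimately show ?thesis
    unfolding set_integrable_def by simp
qed

text \<open>
  A test function supported away from the origin is in particular continuous with compact support,
  which is all that the duality between \<open>w\<close> and its Fourier transform asks of it.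
\<close>

lemma frac_deriv_L2_exists:
  assumes F: "has_fourier T F" and H: "(\<lambda>\<xi>. (norm \<xi> powr a) *\<^sub>R F \<xi>) \<in> L2"
  shows "\<exists>w\<in>L2. is_frac_deriv a T (regular_distr w)
           \<and> L2_norm w \<le> L2_norm (\<lambda>\<xi>. (norm \<xi> powr a) *\<^sub>R F \<xi>)"
proof -
  obtain w where w: "w \<in> L2" "L2_norm w \<le> L2_norm (\<lambda>\<xi>. (norm \<xi> powr a) *\<^sub>R F \<xi>)"
    and dual: "\<forall>f K. continuous_on UNIV f \<longrightarrow> compact K \<longrightarrow> (\<forall>x. x \<notin> K \<longrightarrow> f x = 0) \<longrightarrow>
       (LINT x|lborel. w x * fourier f x) = (LINT \<xi>|lborel. ((norm \<xi> powr a) *\<^sub>R F \<xi>) * f \<xi>)"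
    by (rule L2_inverse_fourier_exists[OF H])
  have "has_fourier (regular_distr w) (\<lambda>\<xi>. (norm \<xi> powr a) *\<^sub>R F \<xi>)"
    unfolding has_fourier_def
  proof (intro conjI allI impI ballI)
    show "(\<lambda>\<xi>. (norm \<xi> powr a) *\<^sub>R F \<xi>) \<in> borel_measurable lborel"
      using H by (simp add: L2_def)
    show "set_integrable lborel K (\<lambda>\<xi>. (norm \<xi> powr a) *\<^sub>R F \<xi>)" if "compact K \<and> 0 \<notin> K" for K
      using that H by (intro L2_set_integrable_compact) auto
    fix f assume f: "f \<in> (test_fun_off0 :: ('a \<Rightarrow> complex) set)"
    then obtain K where K: "compact K" "\<And>x. x \<notin> K \<Longrightarrow> f x = 0"
      unfolding test_fun_off0_def by blast
    have "iter_partial [] f differentiable_on UNIV"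
      using f unfolding test_fun_off0_def smooth_def by (auto dest: spec[of _ "[]"])
    then have "continuous_on UNIV f"
      by (simp add: differentiable_imp_continuous_on)
    with dual K have "(LINT x|lborel. w x * fourier f x) = (LINT \<xi>|lborel. ((norm \<xi> powr a) *\<^sub>R F \<xi>) * f \<xi>)"
      by blast
    then show "regular_distr w (fourier f) = (LINT \<xi>|lborel. ((norm \<xi> powr a) *\<^sub>R F \<xi>) * f \<xi>)"
      by (simp add: regular_distr_def)
  qed
  with F w show ?thesis
    unfolding is_frac_deriv_def by blast
qed

lemma L2_norm_le_of_pointwise:
  assumes H[measurable]: "H \<in> borel_measurable lborel" and ab: "a \<in> L2" "b \<in> L2" and "0 \<le> \<kappa>"
    and le: "AE \<xi> in lborel. norm (H \<xi>) \<le> \<kappa> * (norm (a \<xi>) + norm (b \<xi>))"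
  shows "H \<in> L2" "L2_norm H \<le> 2 * \<kappa> * (L2_norm a + L2_norm b)"
proof -
  have int: "integrable lborel (\<lambda>\<xi>. (norm (a \<xi>))\<^sup>2)" "integrable lborel (\<lambda>\<xi>. (norm (b \<xi>))\<^sup>2)"
    using ab by (auto simp: L2_def)
  have nonneg: "0 \<le> L2_norm a" "0 \<le> L2_norm b"
    by (simp_all add: L2_norm_def integral_nonneg_AE)
  have "L2_sq H \<le> (\<integral>\<^sup>+\<xi>. ennreal (2 * \<kappa>\<^sup>2 * ((norm (a \<xi>))\<^sup>2 + (norm (b \<xi>))\<^sup>2)) \<partial>lborel)"
    unfolding L2_sq_def
  proof (intro nn_integral_mono_AE, use le in eventually_elim)
    fix \<xi> assume "norm (H \<xi>) \<le> \<kappa> * (norm (a \<xi>) + norm (b \<xi>))"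
    then have "(norm (H \<xi>))\<^sup>2 \<le> (\<kappa> * (norm (a \<xi>) + norm (b \<xi>)))\<^sup>2"
      by (intro power_mono) simp_all
    also have "\<dots> = \<kappa>\<^sup>2 * (norm (a \<xi>) + norm (b \<xi>))\<^sup>2"
      by (rule power_mult_distrib)
    also have "\<dots> \<le> \<kappa>\<^sup>2 * (2 * ((norm (a \<xi>))\<^sup>2 + (norm (b \<xi>))\<^sup>2))"
      using sum_squares_bound[of "norm (a \<xi>)" "norm (b \<xi>)"]
      by (intro mult_left_mono) (simp_all add: power2_sum)
    finally show "ennreal ((norm (H \<xi>))\<^sup>2) \<le> ennreal (2 * \<kappa>\<^sup>2 * ((norm (a \<xi>))\<^sup>2 + (norm (b \<xi>))\<^sup>2))"
      by (intro ennreal_leI) (simp only: mult_ac)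
  qed
  also have "\<dots> = ennreal (LINT \<xi>|lborel. 2 * \<kappa>\<^sup>2 * ((norm (a \<xi>))\<^sup>2 + (norm (b \<xi>))\<^sup>2))"
    by (intro nn_integral_eq_integral integrable_mult_right Bochner_Integration.integrable_add int) simp
  also have "(LINT \<xi>|lborel. 2 * \<kappa>\<^sup>2 * ((norm (a \<xi>))\<^sup>2 + (norm (b \<xi>))\<^sup>2))
      = 2 * \<kappa>\<^sup>2 * ((L2_norm a)\<^sup>2 + (L2_norm b)\<^sup>2)"
    using int by (simp add: L2_norm_def integral_nonneg_AE)
  also have "\<dots> \<le> (2 * \<kappa> * (L2_norm a + L2_norm b))\<^sup>2"
  proof -
    have "(2 * \<kappa> * (x + y))\<^sup>2 = 2 * \<kappa>\<^sup>2 * (x\<^sup>2 + y\<^sup>2) + 2 * \<kappa>\<^sup>2 * (x\<^sup>2 + y\<^sup>2) + 8 * \<kappa>\<^sup>2 * (x * y)" for x y :: real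
      by (simp add: power2_eq_square algebra_simps)
    then show ?thesis using nonneg by simp
  qed
  finally have "L2_sq H \<le> ennreal ((2 * \<kappa> * (L2_norm a + L2_norm b))\<^sup>2)"
    by (simp add: ennreal_leI)
  moreover have "0 \<le> 2 * \<kappa> * (L2_norm a + L2_norm b)"
    using nonneg \<open>0 \<le> \<kappa>\<close> by simp
  ultimately show "H \<in> L2" "L2_norm H \<le> 2 * \<kappa> * (L2_norm a + L2_norm b)"
    using H by (auto intro: L2_norm_le_of_L2_sq_le)
qed

lemma integral_Icc_le_set_lebesgue_integral:
  fixes f :: "real \<Rightarrow> real"
  assumes f: "set_integrable lborel {0..} f" and nonneg: "\<And>t. 0 \<le> t \<Longrightarrow> 0 \<le> f t"
  shows "integral {0..T} f \<le> (LINT t:{0..}|lborel. f t)"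
proof -
  have sub: "set_integrable lborel {0..T} f"
    using f by (rule set_integrable_subset) auto
  have "integral {0..T} f = (LINT t:{0..T}|lborel. f t)"
    by (rule set_borel_integral_eq_integral(2)[OF sub, symmetric])
  also have "\<dots> \<le> (LINT t:{0..}|lborel. f t)"
    using f sub nonneg unfolding set_lebesgue_integral_def set_integrable_def
    by (intro integral_mono) (auto simp: indicator_def)
  finally show ?thesis .
qed

text \<open>
  As \<open>1 / g\<close> decreases, its integral over \<open>[0, T]\<close> is at least \<open>T / g T\<close>. This is how a factor of
  time is traded for a factor of \<open>g\<close>.
\<close>

lemma le_mult_integral_inverse_of_mono:
  fixes g g' :: "real \<Rightarrow> real"
  assumes "0 \<le> T"
    and g: "\<And>t. t \<in> {0..T} \<Longrightarrow> (g has_real_derivative g' t) (at t within {0..T})"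
    and g_pos: "\<And>t. t \<in> {0..T} \<Longrightarrow> 0 < g t"
    and g'_nonneg: "\<And>t. t \<in> {0..T} \<Longrightarrow> 0 \<le> g' t"
  shows "T \<le> g T * integral {0..T} (\<lambda>s. 1 / g s)" "g 0 \<le> g T"
proof -
  have mono: "g s \<le> g T" if "s \<in> {0..T}" for s
  proof -
    have "- g T \<le> - g s"
    proof (rule DERIV_within_Icc_nonpos_imp_le[where f = "\<lambda>t. - g t" and f' = "\<lambda>t. - g' t"])
      fix t assume "t \<in> {s..T}"
      then have t: "t \<in> {0..T}" using that by auto
      show "((\<lambda>t. - g t) has_real_derivative - g' t) (at t within {s..T})"
        using that by (intro DERIV_minus DERIV_subset[OF g[OF t]]) auto
      show "- g' t \<le> 0" using g'_nonneg[OF t] by simp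
    qed (use that in auto)
    then show ?thesis by simp
  qed
  show "g 0 \<le> g T" using mono[of 0] \<open>0 \<le> T\<close> by simp
  have "continuous_on {0..T} g"
    using g by (rule DERIV_continuous_on)
  then have "(\<lambda>s. 1 / g s) integrable_on {0..T}"
    using g_pos by (intro integrable_continuous_real continuous_intros) force+
  then have "integral {0..T} (\<lambda>s. 1 / g T) \<le> integral {0..T} (\<lambda>s. 1 / g s)"
    using mono g_pos \<open>0 \<le> T\<close>
    by (intro integral_le) (auto intro!: divide_left_mono mult_pos_pos)
  then have "T / g T \<le> integral {0..T} (\<lambda>s. 1 / g s)"
    using \<open>0 \<le> T\<close> by simp
  then show "T \<le> g T * integral {0..T} (\<lambda>s. 1 / g s)"
    using g_pos[of T] \<open>0 \<le> T\<close> by (simp add: field_simps)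
qed

text \<open>
  With the weights \<open>p powr \<beta>\<close> and \<open>p powr (\<beta> - 2)\<close> of the two data norms, the factor \<open>1 / p\<^sup>2\<close> in front of
  the initial velocity and the factor \<open>p\<^sup>2\<close> in front of the forcing are exactly compensated, so the
  constants depend on \<open>g\<close> alone.
\<close>

lemma damped_wave_mode_bounds:
  fixes v v' v'' :: "real \<Rightarrow> complex" and b g g' :: "real \<Rightarrow> real" and p \<beta> :: real
  assumes "0 < p"
    and g: "\<And>t. 0 \<le> t \<Longrightarrow> (g has_real_derivative g' t) (at t within {0..})"
    and g_pos: "\<And>t. 0 \<le> t \<Longrightarrow> 0 < g t" and g'_nonneg: "\<And>t. 0 \<le> t \<Longrightarrow> 0 \<le> g' t"
    and g_int: "set_integrable lborel {0..} (\<lambda>t. 1 / g t)"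
    and b: "continuous_on {0..} b" "\<And>t. 0 \<le> t \<Longrightarrow> 0 \<le> b t"
    and v: "\<And>t. 0 \<le> t \<Longrightarrow> (v has_vector_derivative v' t) (at t within {0..})"
    and v': "\<And>t. 0 \<le> t \<Longrightarrow> (v' has_vector_derivative v'' t) (at t within {0..})"
    and eq: "\<And>t. 0 \<le> t \<Longrightarrow> v'' t + p\<^sup>2 *\<^sub>R v t + (b t + g t * p\<^sup>2) *\<^sub>R v' t = 0"
    and "0 \<le> t"
  defines "I \<equiv> (LINT t:{0..}|lborel. 1 / g t)"
  defines "K \<equiv> exp I * (1 + 1 / g 0)"
  defines "D \<equiv> p powr \<beta> * norm (v 0) + p powr (\<beta> - 2) * norm (v' 0)"
  shows "p powr \<beta> * norm (v t) \<le> K * D"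
    and "p powr (\<beta> - 2) * norm (v' t) \<le> g t * (1 / g 0 + I * K) * D"
proof -
  define M where "M = exp I * (norm (v 0) + norm (v' 0) / (g 0 * p\<^sup>2))"
  define q where "q = p powr (\<beta> - 2)"
  have p2: "0 < p\<^sup>2" using \<open>0 < p\<close> by simp
  have g0: "0 < g 0" by (simp add: g_pos)
  have q: "0 \<le> q" "p powr \<beta> = q * p\<^sup>2"
    using \<open>0 < p\<close> by (simp_all add: q_def powr_diff)
  have D: "D = q * p\<^sup>2 * norm (v 0) + q * norm (v' 0)"
    by (simp only: D_def q(2) q_def[symmetric])
  have I_ge: "integral {0..T} (\<lambda>s. 1 / g s) \<le> I" for T
    unfolding I_def using g_int by (rule integral_Icc_le_set_lebesgue_integral) (simp add: g_pos less_imp_le)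
  have sub: "{0..T} \<subseteq> {0..}" for T :: real by auto
  have g_Icc: "(g has_real_derivative g' s) (at s within {0..T})" if "s \<in> {0..T}" for s T
    using that by (intro DERIV_subset[OF g sub]) simp
  have v_Icc: "(v has_vector_derivative v' s) (at s within {0..T})" if "s \<in> {0..T}" for s T
    using that by (intro has_vector_derivative_within_subset[OF v sub]) simp
  have v'_Icc: "(v' has_vector_derivative v'' s) (at s within {0..T})" if "s \<in> {0..T}" for s T
    using that by (intro has_vector_derivative_within_subset[OF v' sub]) simp
  have cont: "continuous_on {0..T} (\<lambda>t. b t + g t * p\<^sup>2)" for T
    using continuous_on_subset[OF b(1) sub, of T] DERIV_continuous_on[OF g_Icc, of T]
    by (intro continuous_intros)
  have vM: "norm (v s) \<le> M" if "0 \<le> s" for s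
  proof -
    have "norm (v s) \<le> (norm (v 0) + norm (v' 0) / (g 0 * p\<^sup>2)) * exp (integral {0..s} (\<lambda>s. 1 / g s))"
      using \<open>0 < p\<close> \<open>0 \<le> s\<close> b(2) g_pos g'_nonneg
      by (intro damped_oscillator_position_bound[OF _ _ v_Icc v'_Icc eq cont _ g_Icc]) auto
    also have "\<dots> \<le> (norm (v 0) + norm (v' 0) / (g 0 * p\<^sup>2)) * exp I"
      using I_ge g0 by (intro mult_left_mono) simp_all
    finally show ?thesis by (simp add: M_def mult.commute)
  qed
  have D_nonneg: "0 \<le> D" using q(1) by (simp add: D)
  have "q * p\<^sup>2 * M = exp I * (q * p\<^sup>2 * norm (v 0) + q * norm (v' 0) / g 0)"
  proof -
    have alg: "q * P * (e * (x + y / (d * P))) = e * (q * P * x + q * y / d)" if "P \<noteq> 0" "d \<noteq> 0" for P e x y d :: real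
      using that by (simp add: field_simps)
    show ?thesis unfolding M_def by (rule alg) (use p2 g0 in auto)
  qed
  also have "\<dots> \<le> exp I * ((1 + 1 / g 0) * D)"
  proof (rule mult_left_mono)
    have "q * norm (v' 0) / g 0 \<le> D / g 0"
      using g0 q(1) by (intro divide_right_mono) (simp_all add: D)
    moreover have "q * p\<^sup>2 * norm (v 0) \<le> D"
      using q(1) by (simp add: D)
    ultimately show "q * p\<^sup>2 * norm (v 0) + q * norm (v' 0) / g 0 \<le> (1 + 1 / g 0) * D"
      by (simp add: distrib_right)
  qed simp
  finally have pM: "q * p\<^sup>2 * M \<le> K * D" by (simp add: K_def mult.assoc)
  show "p powr \<beta> * norm (v t) \<le> K * D"
    unfolding q(2)
    by (rule order_trans[OF mult_left_mono[OF vM[OF \<open>0 \<le> t\<close>]] pM]) (simp add: q(1))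
  have g_pos_Icc: "0 < g s" and g'_Icc: "0 \<le> g' s" if "s \<in> {0..t}" for s
    using that g_pos g'_nonneg by simp_all
  have g_mono: "g 0 \<le> g t"
    by (rule le_mult_integral_inverse_of_mono(2)[OF \<open>0 \<le> t\<close> g_Icc g_pos_Icc g'_Icc])
  have "t \<le> g t * integral {0..t} (\<lambda>s. 1 / g s)"
    by (rule le_mult_integral_inverse_of_mono(1)[OF \<open>0 \<le> t\<close> g_Icc g_pos_Icc g'_Icc])
  also have "g t * integral {0..t} (\<lambda>s. 1 / g s) \<le> g t * I"
    using I_ge g_pos[OF \<open>0 \<le> t\<close>] by simp
  finally have t_le: "t \<le> g t * I" .
  have "norm (v' t) \<le> norm (v' 0) + p\<^sup>2 * M * t"
    using \<open>0 \<le> t\<close> b(2) g_pos vM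
    by (intro damped_oscillator_velocity_bound[OF _ _ v'_Icc eq cont]) (auto simp: less_imp_le)
  then have "q * norm (v' t) \<le> q * (norm (v' 0) + p\<^sup>2 * M * t)"
    by (rule mult_left_mono) (rule q(1))
  also have "\<dots> = q * norm (v' 0) + (q * p\<^sup>2 * M) * t"
    by (simp only: distrib_left mult.assoc)
  also have "\<dots> \<le> g t / g 0 * D + (K * D) * (g t * I)"
  proof (rule add_mono)
    have "q * norm (v' 0) \<le> 1 * D" using q(1) by (simp add: D)
    also have "\<dots> \<le> g t / g 0 * D"
      using g_mono g0 D_nonneg by (intro mult_right_mono) simp_all
    finally show "q * norm (v' 0) \<le> g t / g 0 * D" .
    show "(q * p\<^sup>2 * M) * t \<le> (K * D) * (g t * I)"
      by (rule mult_mono[OF pM t_le]) (use \<open>0 \<le> t\<close> D_nonneg g0 in \<open>simp_all add: K_def\<close>)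
  qed
  also have "\<dots> = g t * (1 / g 0 + I * K) * D"
    by (simp add: algebra_simps)
  finally show "p powr (\<beta> - 2) * norm (v' t) \<le> g t * (1 / g 0 + I * K) * D"
    unfolding q_def .
qed

theorem theorem2p1:
  fixes g g' g'' G b b' :: "real \<Rightarrow> real"
    and C1 C2 Ct c \<beta> :: real
  assumes g': "\<And>t. t \<ge> 0 \<Longrightarrow> (g has_real_derivative g' t) (at t within {0..})"
    and g'': "\<And>t. t \<ge> 0 \<Longrightarrow> (g' has_real_derivative g'' t) (at t within {0..})"
    and b': "\<And>t. t \<ge> 0 \<Longrightarrow> (b has_real_derivative b' t) (at t within {0..})"
    and G: "\<And>t. t \<ge> 0 \<Longrightarrow> G t = 1 / 2 * (LINT \<tau>:{0..t}|lborel. g \<tau>)"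
    and A1: "\<And>t. t \<ge> 0 \<Longrightarrow> g t > 0" "\<And>t. t \<ge> 0 \<Longrightarrow> g' t > 0"
    and A2: "set_integrable lborel {0..} (\<lambda>t. 1 / g t)"
    and A3_const: "C1 > 0" "C2 > 0"
    and A3: "\<And>t. t > 0 \<Longrightarrow> \<bar>g' t\<bar> \<le> C1 * g t * (g t / G t)"
            "\<And>t. t > 0 \<Longrightarrow> \<bar>g'' t\<bar> \<le> C2 * g t * (g t / G t)\<^sup>2"
    and b_pos: "\<And>t. t \<ge> 0 \<Longrightarrow> b t > 0"
    and A'1: "\<And>t. t \<ge> 0 \<Longrightarrow> b' t < 0" "set_integrable lborel {0..} b"
    and A'2: "Ct > 0" "\<And>t. t > 0 \<Longrightarrow> b t \<le> Ct * (g t / G t)"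
    and A'3: "c > 0" "\<And>t. t \<ge> 0 \<Longrightarrow> \<bar>b' t\<bar> \<le> c * (b t / (1 + t))"
    and \<beta>: "\<beta> \<ge> 2"
  shows "\<exists>C>0. \<forall>(u0 :: (real ^ 'n) distribution) u1 u ut.
           u0 \<in> Hdot \<beta> \<longrightarrow> u1 \<in> Hdot (\<beta> - 2) \<longrightarrow> sobolev_solution b g u0 u1 u ut \<longrightarrow>
           (\<forall>t\<ge>0.
              (\<exists>w\<in>L2. is_frac_deriv \<beta> (u t) (regular_distr w) \<and>
                 L2_norm w \<le> C * (Hdot_norm \<beta> u0 + Hdot_norm (\<beta> - 2) u1)) \<and>
              (\<exists>w\<in>L2. is_frac_deriv (\<beta> - 2) (ut t) (regular_distr w) \<and>
                 L2_norm w \<le> C * (g t * (Hdot_norm \<beta> u0 + Hdot_norm (\<beta> - 2) u1))))"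
proof -
  define I where "I = (LINT t:{0..}|lborel. 1 / g t)"
  define K where "K = exp I * (1 + 1 / g 0)"
  define L where "L = 1 / g 0 + I * K"
  have g0: "0 < g 0" by (simp add: A1)
  have "0 \<le> I"
    using integral_Icc_le_set_lebesgue_integral[OF A2, of 0] A1(1) by (simp add: I_def less_imp_le)
  then have K: "0 < K" and L: "0 < L"
    using g0 by (simp_all add: K_def L_def add_pos_pos add_pos_nonneg)
  have b_cont: "continuous_on {0..} b"
    using b' by (auto intro: DERIV_continuous_on)
  have main: "(\<exists>w\<in>L2. is_frac_deriv \<beta> (u t) (regular_distr w) \<and>
                 L2_norm w \<le> 2 * (K + L) * (Hdot_norm \<beta> u0 + Hdot_norm (\<beta> - 2) u1)) \<and>
              (\<exists>w\<in>L2. is_frac_deriv (\<beta> - 2) (ut t) (regular_distr w) \<and>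
                 L2_norm w \<le> 2 * (K + L) * (g t * (Hdot_norm \<beta> u0 + Hdot_norm (\<beta> - 2) u1)))"
    if u0: "u0 \<in> Hdot \<beta>" and u1: "u1 \<in> Hdot (\<beta> - 2)"
      and sol: "sobolev_solution b g u0 u1 u ut" and t: "0 \<le> t"
    for u0 u1 :: "(real ^ 'n) distribution" and u ut t
  proof -
    obtain v vt vtt :: "real \<Rightarrow> real ^ 'n \<Rightarrow> complex"
      where F: "has_fourier (u t) (v t)" "has_fourier (ut t) (vt t)"
        and ode: "AE \<xi> in lborel.
           (\<forall>t\<ge>0. ((\<lambda>s. v s \<xi>) has_vector_derivative vt t \<xi>) (at t within {0..}) \<and>
                   ((\<lambda>s. vt s \<xi>) has_vector_derivative vtt t \<xi>) (at t within {0..}) \<and>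
                   vtt t \<xi> + (norm \<xi>)\<^sup>2 *\<^sub>R v t \<xi> + (b t + g t * (norm \<xi>)\<^sup>2) *\<^sub>R vt t \<xi> = 0) \<and>
           v 0 \<xi> = fourier_fun u0 \<xi> \<and> vt 0 \<xi> = fourier_fun u1 \<xi>"
      using sol t unfolding sobolev_solution_def by blast
    define a0 where "a0 \<xi> = (norm \<xi> powr \<beta>) *\<^sub>R fourier_fun u0 \<xi>" for \<xi>
    define a1 where "a1 \<xi> = (norm \<xi> powr (\<beta> - 2)) *\<^sub>R fourier_fun u1 \<xi>" for \<xi>
    have a: "a0 \<in> L2" "a1 \<in> L2"
      using u0 u1 by (simp_all add: Hdot_def a0_def[abs_def] a1_def[abs_def])
    have N: "L2_norm a0 = Hdot_norm \<beta> u0" "L2_norm a1 = Hdot_norm (\<beta> - 2) u1"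
      by (simp_all add: Hdot_norm_def a0_def[abs_def] a1_def[abs_def])
    have N_nonneg: "0 \<le> L2_norm a0 + L2_norm a1"
      by (simp add: L2_norm_def integral_nonneg_AE)
    have [measurable]: "v t \<in> borel_measurable borel" "vt t \<in> borel_measurable borel"
      using F by (simp_all add: has_fourier_def)
    have pointwise: "AE \<xi> in lborel.
        norm ((norm \<xi> powr \<beta>) *\<^sub>R v t \<xi>) \<le> K * (norm (a0 \<xi>) + norm (a1 \<xi>)) \<and>
        norm ((norm \<xi> powr (\<beta> - 2)) *\<^sub>R vt t \<xi>) \<le> (g t * L) * (norm (a0 \<xi>) + norm (a1 \<xi>))"
      \<comment> \<open>the frequency 0 is a null set and is left out because the bounds for a mode divide by the frequency\<close>
      using ode AE_lborel_singleton[of "0 :: real ^ 'n"]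
    proof eventually_elim
      case (elim \<xi>)
      then have "0 < norm \<xi>" by simp
      from damped_wave_mode_bounds[OF this g' A1(1) less_imp_le[OF A1(2)] A2 b_cont less_imp_le[OF b_pos],
          of "\<lambda>s. v s \<xi>" "\<lambda>s. vt s \<xi>" "\<lambda>s. vtt s \<xi>" t \<beta>] elim t
      show ?case
        by (simp add: a0_def a1_def I_def K_def L_def)
    qed
    have "(\<exists>w\<in>L2. is_frac_deriv \<beta> (u t) (regular_distr w) \<and> L2_norm w \<le> 2 * K * (L2_norm a0 + L2_norm a1))"
    proof -
      have "AE \<xi> in lborel. norm ((norm \<xi> powr \<beta>) *\<^sub>R v t \<xi>) \<le> K * (norm (a0 \<xi>) + norm (a1 \<xi>))"
        using pointwise by eventually_elim simp
      from L2_norm_le_of_pointwise[OF _ a less_imp_le[OF K] this]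
      show ?thesis using frac_deriv_L2_exists[OF F(1), of \<beta>] by (force intro: order_trans)
    qed
    moreover have "(\<exists>w\<in>L2. is_frac_deriv (\<beta> - 2) (ut t) (regular_distr w) \<and> L2_norm w \<le> 2 * (g t * L) * (L2_norm a0 + L2_norm a1))"
    proof -
      have "AE \<xi> in lborel. norm ((norm \<xi> powr (\<beta> - 2)) *\<^sub>R vt t \<xi>) \<le> (g t * L) * (norm (a0 \<xi>) + norm (a1 \<xi>))"
        using pointwise by eventually_elim simp
      from L2_norm_le_of_pointwise[OF _ a _ this]
      show ?thesis using frac_deriv_L2_exists[OF F(2), of "\<beta> - 2"] A1(1)[OF t] L by (force intro: order_trans)
    qed
    moreover have "2 * K * (L2_norm a0 + L2_norm a1) \<le> 2 * (K + L) * (L2_norm a0 + L2_norm a1)"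
      using L N_nonneg by (intro mult_right_mono) simp_all
    moreover have "2 * (g t * L) * (L2_norm a0 + L2_norm a1) \<le> 2 * (K + L) * (g t * (L2_norm a0 + L2_norm a1))"
    proof -
      have "2 * L * (g t * (L2_norm a0 + L2_norm a1)) \<le> 2 * (K + L) * (g t * (L2_norm a0 + L2_norm a1))"
        using K N_nonneg A1(1)[OF t] by (intro mult_right_mono) simp_all
      moreover have "2 * (g t * L) * (L2_norm a0 + L2_norm a1) = 2 * L * (g t * (L2_norm a0 + L2_norm a1))"
        by (simp only: mult_ac)
      ultimately show ?thesis by (simp only:)
    qed
    ultimately show ?thesis
      unfolding N by (meson order_trans)
  qed
  then show ?thesis
    using K L by (intro exI[of _ "2 * (K + L)"]) simp
qed

end
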